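(* Let $\rightsquigarrow$ be a 9-eternal relation, $G$ a finite group, $p$ a prime divisor of $|G|$, and $S$ a Sylow $p$-subgroup of $G$. Suppose that there exists a subgroup $D$ of $S$ with $1<|D|<|S|$ such that every subgroup of $S$ of order $|D|$ or $p|D|$ is abelian, and every subgroup $H$ of $S$ of order $|D|$ or $p|D|$ satisfies $H\rightsquigarrow G$. Then $\mathcal{F}_S(G)$ is supersolvable.
   Context: All groups are finite. $Z_{\mathfrak{U}}(G)$ denotes the supersolvable hypercenter of $G$: the largest normal subgroup $N$ of $G$ such that every chief factor of $G$ below $N$ is cyclic (of prime order). Let $\rightsquigarrow$ be a relation, defined for every finite group $G$, between subgroups $H\le G$ and $G$ (written $H\rightsquigarrow G$). It is called 9-eternal if for every finite group $G$ the following hold: (0) for all subgroups $H\le K\le G$, if $H\rightsquigarrow G$ then $H\rightsquigarrow K$; (9) for every prime divisor $p$ of $|G|$: if there exists a subgroup $D$ of $O_p(G)$ with $1<|D|<|O_p(G)|$ such that every subgroup $H$ of $O_p(G)$ of order $|D|$ or $p|D|$ satisfies $H\rightsquigarrow G$, then $O_p(G)\le Z_{\mathfrak{U}}(G)$. $\mathcal{F}_S(G)$ is the (saturated) fusion system on $S\in\mathrm{Syl}_p(G)$ whose objects are the subgroups of $S$ and whose morphisms $P\to Q$ are the maps $x\mapsto x^g$ with $g\in G$, $P^g\le Q$. A saturated fusion system $\mathcal{F}$ on a $p$-group $S$ is supersolvable if there is a series $1=S_0\le S_1\le\cdots\le S_n=S$ of strongly $\mathcal{F}$-closed subgroups of $S$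 with $S_{i+1}/S_i$ cyclic for $0\le i\le n-1$. (A subgroup $T\le S$ is strongly $\mathcal{F}$-closed if for every $P\le T$ and every $\phi\in\mathrm{Hom}_{\mathcal{F}}(P,S)$ one has $P^{\phi}\le T$.) *)

theory Defs
  imports "HOL-Algebra.Algebra" "HOL-Library.FuncSet"
begin

(* A subgroup H of G, regarded as a group, is G\<lparr>carrier := H\<rparr>. *)

definition minimal_normal :: "'a set \<Rightarrow> ('a, 'b) monoid_scheme \<Rightarrow> bool" where
  "minimal_normal N G \<longleftrightarrow>
     N \<lhd> G \<and> N \<noteq> {\<one>\<^bsub>G\<^esub>} \<and> (\<forall>L. L \<lhd> G \<and> L \<subseteq> N \<longrightarrow> L = {\<one>\<^bsub>G\<^esub>} \<or> L = N)"

(* The set of cosets H/K is the carrier of (G\<lparr>carrier := H\<rparr>) Mod K. *)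
definition chief_factor :: "('a, 'b) monoid_scheme \<Rightarrow> 'a set \<Rightarrow> 'a set \<Rightarrow> bool" where
  "chief_factor G H K \<longleftrightarrow>
     H \<lhd> G \<and> K \<lhd> G \<and> K \<subseteq> H \<and> minimal_normal (carrier (G\<lparr>carrier := H\<rparr> Mod K)) (G Mod K)"

(* "Largest" is literal: Greatest with respect to inclusion.  For finite G it exists, since the
   product of two normal subgroups with the stated property has the property again; the same
   applies to the p-core below. *)
definition supersolvable_hypercenter :: "('a, 'b) monoid_scheme \<Rightarrow> 'a set" where
  "supersolvable_hypercenter G =
     (GREATEST N. N \<lhd> G \<and>
        (\<forall>H K. chief_factor G H K \<and> H \<subseteq> N \<longrightarrow> cyclic_group (G\<lparr>carrier := H\<rparr> Mod K)))"

definition p_core :: "nat \<Rightarrow> ('a, 'b) monoid_scheme \<Rightarrow> 'a set" where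
  "p_core p G = (GREATEST N. N \<lhd> G \<and> (\<exists>n. card N = p ^ n))"

definition sylow_subgroup :: "nat \<Rightarrow> ('a, 'b) monoid_scheme \<Rightarrow> 'a set \<Rightarrow> bool" where
  "sylow_subgroup p G S \<longleftrightarrow> subgroup S G \<and> card S = p ^ Factorial_Ring.multiplicity p (Coset.order G)"

(* rel H G stands for the relation between a subgroup H of G and G; its values at pairs where H
   is not a subgroup of G are irrelevant.  "Every finite group" is every finite group whose
   elements lie in the type 'a.  Both conditions relate G only to its own subgroups, so this is
   no loss: a relation on all finite groups restricts to one on 'a, and conversely one on 'a
   extends by False to all other groups, both operations preserving (0) and (9). *)
definition eternal9 :: "('a set \<Rightarrow> 'a monoid \<Rightarrow> bool) \<Rightarrow> bool" where
  "eternal9 rel \<longleftrightarrow>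
     (\<forall>G. group G \<and> finite (carrier G) \<longrightarrow>
        (\<forall>H K. subgroup K G \<and> subgroup H (G\<lparr>carrier := K\<rparr>) \<and> rel H G
               \<longrightarrow> rel H (G\<lparr>carrier := K\<rparr>)) \<and>
        (\<forall>p. Factorial_Ring.prime p \<and> p dvd Coset.order G \<and>
             (\<exists>D. subgroup D (G\<lparr>carrier := p_core p G\<rparr>) \<and>
                  1 < card D \<and> card D < card (p_core p G) \<and>
                  (\<forall>H. subgroup H (G\<lparr>carrier := p_core p G\<rparr>) \<and>
                       (card H = card D \<or> card H = p * card D) \<longrightarrow> rel H G))
             \<longrightarrow> p_core p G \<subseteq> supersolvable_hypercenter G))"

(* A fusion system on a p-group S is represented by its family of morphism sets
   F P Q = Hom_F(P, Q), empty unless P and Q are subgroups of S.  Morphisms are extensional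
   functions on P, so that maps agreeing on P are identified. *)
type_synonym 'a fusion = "'a set \<Rightarrow> 'a set \<Rightarrow> ('a \<Rightarrow> 'a) set"

definition group_fusion :: "('a, 'b) monoid_scheme \<Rightarrow> 'a set \<Rightarrow> 'a fusion" where
  "group_fusion G S P Q =
     {\<phi>. subgroup P (G\<lparr>carrier := S\<rparr>) \<and> subgroup Q (G\<lparr>carrier := S\<rparr>) \<and>
         (\<exists>g \<in> carrier G. \<phi> = (\<lambda>x\<in>P. inv\<^bsub>G\<^esub> g \<otimes>\<^bsub>G\<^esub> x \<otimes>\<^bsub>G\<^esub> g) \<and> \<phi> ` P \<subseteq> Q)}"

definition strongly_closed :: "'a fusion \<Rightarrow> ('a, 'b) monoid_scheme \<Rightarrow> 'a set \<Rightarrow> bool" where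
  "strongly_closed F S T \<longleftrightarrow>
     subgroup T S \<and> (\<forall>P \<phi>. subgroup P (S\<lparr>carrier := T\<rparr>) \<and> \<phi> \<in> F P (carrier S) \<longrightarrow> \<phi> ` P \<subseteq> T)"

(* S is the underlying p-group.  In a fusion system, strongly closed subgroups are normal in S;
   normality is stated here only so that the quotient is visibly a group.  Saturation is not part
   of the definition: the notion is meant for saturated F, and every group_fusion G S with S a
   Sylow p-subgroup of the finite group G is saturated. *)
definition supersolvable_fusion :: "'a fusion \<Rightarrow> ('a, 'b) monoid_scheme \<Rightarrow> bool" where
  "supersolvable_fusion F S \<longleftrightarrow>
     (\<exists>(n::nat) T. T 0 = {\<one>\<^bsub>S\<^esub>} \<and> T n = carrier S \<and>
        (\<forall>i\<le>n. strongly_closed F S (T i)) \<and>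
        (\<forall>i<n. T i \<subseteq> T (Suc i) \<and> T i \<lhd> S\<lparr>carrier := T (Suc i)\<rparr> \<and>
               cyclic_group (S\<lparr>carrier := T (Suc i)\<rparr> Mod T i)))"

end

theory Submission
  imports Defs
begin

text \<open>
  It suffices to show that the normalizer of S controls fusion in S: by (9) applied to the normalizer K
  of S, whose p-core is S, the chief series of K through S has cyclic factors, and its terms are then
  strongly closed.
  Control of fusion is proved by Alperin's induction, which reduces it to a fully normalized Q < S:
  every x normalizing Q has to be corrected by an element centralizing Q so that it normalizes some
  larger subgroup of S. Let L be the normalizer of Q, with Sylow subgroup R = L \<inter> S.

  If |Q| \<le> |D|, then Q lies in an abelian subgroup of S of order p|D|, so the Sylow subgroup of the
  centralizer of Q given by R properly contains Q, and the Frattini argument applies to it.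
  If |Q| > |D| and the p-core of L is larger than Q, then it is normalized by x itself.
  If |Q| > |D| and Q is the p-core of L, then (0) and (9) make the chief factors of L below Q cyclic,
  so the image of R in the automizer of Q is normal, and the Frattini argument shows that x can be
  corrected to normalize R.
\<close>

section \<open>Conjugation\<close>

text \<open>Condition (9) speaks only about p-cores, and the p-core of G itself may be trivial.
  Hence it is applied to normalizers of subgroups Q of S, to which (0) passes the relation. There Q
  is a normal p-subgroup, and (9) yields cyclic chief factors below Q once Q is the whole p-core and
  has order above |D|. The three cases separate these two provisos; the abelian subgroups of order
  p|D| serve the orders that (9) does not reach. A correction by an element centralizing Q costs
  nothing, since only the map induced on Q matters. In return the corrected element acts on a larger
  subgroup of S, for which control of fusion is already known by induction. That R is such a larger
  subgroup comes from the growth of normalizers in p-groups: Q < S forces Q < R. The image of R in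
  the automizer is normal because the elements acting trivially on all chief factors below Q induce
  a p-group on Q, and R already induces all of it.\<close>

definition conjg :: "('a, 'b) monoid_scheme \<Rightarrow> 'a \<Rightarrow> 'a \<Rightarrow> 'a" where
  "conjg G g x = inv\<^bsub>G\<^esub> g \<otimes>\<^bsub>G\<^esub> x \<otimes>\<^bsub>G\<^esub> g"

definition centralizer :: "('a, 'b) monoid_scheme \<Rightarrow> 'a set \<Rightarrow> 'a set" where
  "centralizer G P = {g \<in> carrier G. \<forall>x\<in>P. conjg G g x = x}"

context group
begin

lemma mult_inv_cancel_left [simp]:
  "\<lbrakk>g \<in> carrier G; y \<in> carrier G\<rbrakk> \<Longrightarrow> g \<otimes> (inv g \<otimes> y) = y"
  "\<lbrakk>g \<in> carrier G; y \<in> carrier G\<rbrakk> \<Longrightarrow> inv g \<otimes> (g \<otimes> y) = y"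
  by (simp_all flip: m_assoc)

lemma conjg_closed [simp]: "\<lbrakk>g \<in> carrier G; x \<in> carrier G\<rbrakk> \<Longrightarrow> conjg G g x \<in> carrier G"
  by (simp add: conjg_def)

lemma conjg_one [simp]: "x \<in> carrier G \<Longrightarrow> conjg G \<one> x = x"
  by (simp add: conjg_def)

lemma conjg_mult:
  "\<lbrakk>g \<in> carrier G; h \<in> carrier G; x \<in> carrier G\<rbrakk> \<Longrightarrow> conjg G (g \<otimes> h) x = conjg G h (conjg G g x)"
  by (simp add: conjg_def inv_mult_group m_assoc)

lemma conjg_inv_cancel [simp]:
  "\<lbrakk>g \<in> carrier G; x \<in> carrier G\<rbrakk> \<Longrightarrow> conjg G (inv g) (conjg G g x) = x"
  "\<lbrakk>g \<in> carrier G; x \<in> carrier G\<rbrakk> \<Longrightarrow> conjg G g (conjg G (inv g) x) = x"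
  by (simp_all flip: conjg_mult)

lemma conjg_hom:
  "\<lbrakk>g \<in> carrier G; x \<in> carrier G; y \<in> carrier G\<rbrakk> \<Longrightarrow> conjg G g (x \<otimes> y) = conjg G g x \<otimes> conjg G g y"
  by (simp add: conjg_def m_assoc)

lemma conjg_inv:
  "\<lbrakk>g \<in> carrier G; x \<in> carrier G\<rbrakk> \<Longrightarrow> conjg G g (inv x) = inv (conjg G g x)"
  by (simp add: conjg_def inv_mult_group m_assoc)

lemma conjg_group_hom: "g \<in> carrier G \<Longrightarrow> group_hom G G (conjg G g)"
  by unfold_locales (auto simp: hom_def conjg_hom)

lemma conjg_int_pow:
  "\<lbrakk>g \<in> carrier G; x \<in> carrier G\<rbrakk> \<Longrightarrow> conjg G g (x [^] (n::int)) = conjg G g x [^] n"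
  by (rule group_hom.hom_int_pow[OF conjg_group_hom])

lemma conjg_inj: "\<lbrakk>g \<in> carrier G; P \<subseteq> carrier G\<rbrakk> \<Longrightarrow> inj_on (conjg G g) P"
  by (rule inj_on_inverseI[where g = "conjg G (inv g)"]) auto

lemma card_conjg [simp]: "\<lbrakk>g \<in> carrier G; P \<subseteq> carrier G\<rbrakk> \<Longrightarrow> card (conjg G g ` P) = card P"
  by (simp add: card_image conjg_inj)

lemma conjg_image_mult:
  "\<lbrakk>g \<in> carrier G; h \<in> carrier G; P \<subseteq> carrier G\<rbrakk> \<Longrightarrow> conjg G (g \<otimes> h) ` P = conjg G h ` conjg G g ` P"
  unfolding image_image by (intro image_cong) (auto simp: conjg_mult subsetD)

lemma conjg_image_one [simp]: "P \<subseteq> carrier G \<Longrightarrow> conjg G \<one> ` P = P"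
  by (auto simp: image_iff subsetD)

lemma conjg_image_inv:
  "\<lbrakk>g \<in> carrier G; P \<subseteq> carrier G; conjg G g ` P = Q\<rbrakk> \<Longrightarrow> conjg G (inv g) ` Q = P"
  using conjg_image_mult[of g "inv g" P] by simp

lemma conjg_image_subset: "\<lbrakk>g \<in> carrier G; P \<subseteq> carrier G\<rbrakk> \<Longrightarrow> conjg G g ` P \<subseteq> carrier G"
  by auto

lemma conjg_subgroup: "\<lbrakk>g \<in> carrier G; subgroup P G\<rbrakk> \<Longrightarrow> subgroup (conjg G g ` P) G"
  using group_hom.subgroup_img_is_subgroup[OF conjg_group_hom] by blast

lemma conjg_consistent [simp]:
  "\<lbrakk>subgroup K G; g \<in> K\<rbrakk> \<Longrightarrow> conjg (G\<lparr>carrier := K\<rparr>) g x = conjg G g x"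
  by (simp add: conjg_def)

lemma finite_subgroup: "\<lbrakk>finite (carrier G); subgroup H G\<rbrakk> \<Longrightarrow> finite H"
  by (meson finite_subset subgroup.subset)

lemma conjg_subset_imp_eq:
  assumes "finite P" "g \<in> carrier G" "P \<subseteq> carrier G" "conjg G g ` P \<subseteq> P"
  shows "conjg G g ` P = P"
  using assms by (simp add: card_subset_eq)

lemma normal_iff_conjg:
  "N \<lhd> G \<longleftrightarrow> subgroup N G \<and> (\<forall>g\<in>carrier G. \<forall>x\<in>N. conjg G g x \<in> N)"
proof (intro iffI conjI ballI)
  fix g x assume "N \<lhd> G" "g \<in> carrier G" "x \<in> N"
  then show "conjg G g x \<in> N" unfolding conjg_def by (rule normal.inv_op_closed1)
next
  assume "N \<lhd> G" then show "subgroup N G" by (rule normal_imp_subgroup)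
next
  assume *: "subgroup N G \<and> (\<forall>g\<in>carrier G. \<forall>x\<in>N. conjg G g x \<in> N)"
  show "N \<lhd> G"
  proof (rule normal_invI)
    show "subgroup N G" using * ..
    fix x h assume x: "x \<in> carrier G" and h: "h \<in> N"
    have "conjg G (inv x) h \<in> N" using * x h inv_closed[OF x] by metis
    then show "x \<otimes> h \<otimes> inv x \<in> N" unfolding conjg_def using x by simp
  qed
qed

lemma normal_conjg_image:
  assumes "N \<lhd> G" "g \<in> carrier G" shows "conjg G g ` N = N"
proof -
  have N: "N \<subseteq> carrier G" using assms(1) normal_imp_subgroup subgroup.subset by blast
  have sub: "conjg G h ` N \<subseteq> N" if "h \<in> carrier G" for h
    using assms(1) that unfolding normal_iff_conjg by blast
  have "conjg G (inv g) ` N \<subseteq> N" by (rule sub) (use assms in simp)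
  then have "conjg G g ` conjg G (inv g) ` N \<subseteq> conjg G g ` N" by (rule image_mono)
  moreover have "conjg G g ` conjg G (inv g) ` N = N"
    using conjg_image_mult[of "inv g" g N] assms(2) N by simp
  ultimately show ?thesis using sub[OF assms(2)] by (simp add: subset_antisym)
qed

lemma subgroup_consistent_iff:
  assumes "subgroup K G"
  shows "subgroup N (G\<lparr>carrier := K\<rparr>) \<longleftrightarrow> subgroup N G \<and> N \<subseteq> K"
proof (intro iffI conjI)
  assume N: "subgroup N (G\<lparr>carrier := K\<rparr>)"
  then show "subgroup N G" by (rule incl_subgroup[OF assms])
  show "N \<subseteq> K" using subgroup.subset[OF N] by simp
qed (simp add: subgroup_incl assms)

text \<open>Normality in a local subgroup, expressed with the operations of the ambient group.
  Several normalizers and centralizers inside one G can then be compared without changing the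
  group.\<close>

lemma normal_consistent_iff:
  assumes "subgroup K G"
  shows "N \<lhd> G\<lparr>carrier := K\<rparr> \<longleftrightarrow> subgroup N G \<and> N \<subseteq> K \<and> (\<forall>g\<in>K. \<forall>x\<in>N. conjg G g x \<in> N)"
proof -
  interpret K: group "G\<lparr>carrier := K\<rparr>" using assms by (rule subgroup_imp_group)
  show ?thesis
    unfolding K.normal_iff_conjg subgroup_consistent_iff[OF assms]
    by (simp add: conjg_consistent[OF assms] cong: ball_cong)
qed

text \<open>\<open>normalizer\<close> is a stabilizer under \<open>g <# P #> inv g\<close>,
  conjugation on the other side. The two descriptions agree because a set is fixed by g exactly when
  it is fixed by \<open>inv g\<close>.\<close>

lemma mem_normalizer:
  assumes "P \<subseteq> carrier G"
  shows "g \<in> normalizer G P \<longleftrightarrow> g \<in> carrier G \<and> conjg G g ` P = P"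
proof (cases "g \<in> carrier G")
  case True
  have "g <# P #> inv g = conjg G (inv g) ` P"
    using True unfolding l_coset_def r_coset_def conjg_def by auto
  moreover have "conjg G (inv g) ` P = P \<longleftrightarrow> conjg G g ` P = P"
    using True assms conjg_image_inv[of g P P] conjg_image_inv[of "inv g" P P]
    by (metis inv_closed inv_inv)
  ultimately show ?thesis
    using True assms by (simp add: normalizer_def stabilizer_def)
qed (simp add: normalizer_def stabilizer_def)

lemma subgroup_subset_normalizer:
  assumes "subgroup P G" shows "P \<subseteq> normalizer G P"
  using subgroup_in_normalizer[OF assms] normal_imp_subgroup subgroup.subset by fastforce

lemma centralizer_subgroup:
  assumes "P \<subseteq> carrier G" shows "subgroup (centralizer G P) G"
proof (rule subgroupI)
  show "centralizer G P \<noteq> {}" using one_closed assms conjg_one unfolding centralizer_def by blast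
next
  fix a assume a: "a \<in> centralizer G P"
  show "inv a \<in> centralizer G P"
    unfolding centralizer_def
  proof (intro CollectI conjI ballI)
    fix x assume x: "x \<in> P"
    have "conjg G (inv a) (conjg G a x) = x"
      using a x assms by (intro conjg_inv_cancel) (auto simp: centralizer_def)
    moreover have "conjg G a x = x" using a x by (simp add: centralizer_def)
    ultimately show "conjg G (inv a) x = x" by simp
  qed (use a in \<open>simp add: centralizer_def\<close>)
qed (use assms in \<open>auto simp: centralizer_def conjg_mult subsetD\<close>)

lemma centralizer_subset_normalizer:
  assumes "P \<subseteq> carrier G" shows "centralizer G P \<subseteq> normalizer G P"
  using assms by (auto simp: centralizer_def mem_normalizer image_iff)

lemma centralizer_antimono: "P \<subseteq> Q \<Longrightarrow> centralizer G Q \<subseteq> centralizer G P"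
  by (auto simp: centralizer_def)

lemma centralizer_conjg:
  assumes "P \<subseteq> carrier G" "g \<in> carrier G" "c \<in> centralizer G P"
  shows "conjg G g c \<in> centralizer G (conjg G g ` P)"
  unfolding centralizer_def
proof (intro CollectI conjI ballI)
  fix y assume "y \<in> conjg G g ` P"
  then obtain x where x: "x \<in> P" "y = conjg G g x" by blast
  have c: "c \<in> carrier G" "conjg G c x = x" using assms x by (auto simp: centralizer_def)
  have xG: "x \<in> carrier G" using x assms by blast
  \<comment> \<open>Acting by g and then by the conjugate of c equals acting by c and then by g; c
    fixes x, so the conjugate of c fixes the image of x.\<close>
  have "g \<otimes> conjg G g c = c \<otimes> g" using c assms by (simp add: conjg_def m_assoc)
  then have "conjg G (conjg G g c) y = conjg G (c \<otimes> g) x"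
    using x(2) xG c assms by (metis conjg_closed conjg_mult)
  also have "\<dots> = conjg G g (conjg G c x)" using xG c assms by (simp add: conjg_mult)
  finally have "conjg G (conjg G g c) y = conjg G g (conjg G c x)" .
  then show "conjg G (conjg G g c) y = y" using c x by simp
qed (use assms in \<open>auto simp: centralizer_def\<close>)

section \<open>Actions of p-groups and the Sylow theorems\<close>

text \<open>Right multiplication reverses products, whereas \<open>group_action\<close> asks for a
  homomorphism into permutations under composition; the inverse repairs the order. The restriction
  is needed because members of \<open>Bij\<close> are extensional.\<close>

lemma rcosets_action:
  assumes "subgroup B G" "subgroup P G"
  shows "group_action (G\<lparr>carrier := P\<rparr>) (rcosets B) (\<lambda>x. \<lambda>C\<in>rcosets B. C #> inv x)"
proof -
  interpret P: group "G\<lparr>carrier := P\<rparr>" using assms(2) subgroup_imp_group by blast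
  have sub: "P \<subseteq> carrier G" and B: "B \<subseteq> carrier G" using assms subgroup.subset by blast+
  have cl: "C #> x \<in> rcosets B" if "C \<in> rcosets B" "x \<in> carrier G" for C x
    using that B by (auto simp: RCOSETS_def coset_mult_assoc)
  have sc: "C \<subseteq> carrier G" if "C \<in> rcosets B" for C
    using that assms(1) using subgroup.rcosets_carrier is_group by blast
  have bij: "(\<lambda>C\<in>rcosets B. C #> inv x) \<in> Bij (rcosets B)" if "x \<in> P" for x
  proof -
    have x: "x \<in> carrier G" using that sub by blast
    have "bij_betw (\<lambda>C. C #> inv x) (rcosets B) (rcosets B)"
      by (rule bij_betw_byWitness[where f' = "\<lambda>C. C #> x"])
         (use x sc cl in \<open>auto simp: coset_mult_assoc\<close>)
    then show ?thesis by (simp add: Bij_def bij_betw_restrict_eq)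
  qed
  have "(\<lambda>C\<in>rcosets B. C #> inv (x \<otimes> y))
      = compose (rcosets B) (\<lambda>C\<in>rcosets B. C #> inv x) (\<lambda>C\<in>rcosets B. C #> inv y)"
    if "x \<in> P" "y \<in> P" for x y
    using that sub sc cl
    by (auto simp: compose_def fun_eq_iff restrict_def coset_mult_assoc inv_mult_group subsetD)
  then show ?thesis
    unfolding group_action_def group_hom_def group_hom_axioms_def
    using assms bij P.is_group group_BijGroup
    by (auto simp: hom_def BijGroup_def subgroup.m_inv_closed)
qed

end

text \<open>The nonfixed points are a union of orbits whose lengths divide p^n and exceed 1.
  Counting the complement of the fixed points serves two purposes: a set without fixed points has
  size divisible by p, and if p divides the size of E, it divides the number of fixed
  points.\<close>

lemma (in group_action) dvd_card_nonfixed_points: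
  assumes p: "Factorial_Ring.prime p" and ord: "Coset.order G = p ^ n" and fin: "finite E"
  shows "p dvd card (E - {x\<in>E. \<forall>g\<in>carrier G. \<phi> g x = x})"
proof -
  define M where "M = {x\<in>E. \<exists>g\<in>carrier G. \<phi> g x \<noteq> x}"
  have orb: "orbit G \<phi> x \<subseteq> M" if x: "x \<in> M" for x
  proof
    fix y assume y: "y \<in> orbit G \<phi> x"
    have xE: "x \<in> E" using x by (simp add: M_def)
    have yE: "y \<in> E" using y xE element_image by (auto simp: orbit_def)
    have "x \<in> orbit G \<phi> y" using orbit_sym[OF xE yE y] .
    then obtain g where g: "g \<in> carrier G" "\<phi> g y = x" by (auto simp: orbit_def)
    obtain h where h: "h \<in> carrier G" "\<phi> h x \<noteq> x" using x by (auto simp: M_def)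
    show "y \<in> M"
    proof (rule ccontr)
      assume "y \<notin> M"
      then have "\<And>g. g \<in> carrier G \<Longrightarrow> \<phi> g y = y" using yE by (auto simp: M_def)
      then show False using g h by metis
    qed
  qed
  have self: "x \<in> orbit G \<phi> x" if "x \<in> E" for x using orbit_refl[OF that] .
  have un: "\<Union>(orbit G \<phi> ` M) = M" using orb self by (auto simp: M_def)
  have "p dvd card (\<Union>(orbit G \<phi> ` M))"
  proof (rule dvd_partition)
    show "finite (\<Union>(orbit G \<phi> ` M))" unfolding un using fin by (simp add: M_def)
    show "\<forall>c\<in>orbit G \<phi> ` M. p dvd card c"
    proof
      fix c assume "c \<in> orbit G \<phi> ` M"
      then obtain x where x: "x \<in> M" "c = orbit G \<phi> x" by blast
      have xE: "x \<in> E" using x by (simp add: M_def)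
      have "card c dvd p ^ n"
        using orbit_stabilizer_theorem[OF xE] ord x(2) by (metis dvd_triv_left)
      then obtain k where k: "card c = p ^ k" using divides_primepow_nat[OF p] by blast
      moreover have "k \<noteq> 0"
      proof
        assume "k = 0"
        then obtain z where z: "c = {z}" using k card_1_singletonE by auto
        obtain h where h: "h \<in> carrier G" "\<phi> h x \<noteq> x" using x by (auto simp: M_def)
        have "\<phi> h x \<in> c" "x \<in> c" using h x xE self by (auto simp: orbit_def)
        then show False using z h by auto
      qed
      ultimately show "p dvd card c" by simp
    qed
    show "\<forall>c1\<in>orbit G \<phi> ` M. \<forall>c2\<in>orbit G \<phi> ` M. c1 \<noteq> c2 \<longrightarrow> c1 \<inter> c2 = {}"
      using disjoint_union by (auto simp: orbits_def M_def)
  qed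
  moreover have "E - {x\<in>E. \<forall>g\<in>carrier G. \<phi> g x = x} = M" by (auto simp: M_def)
  ultimately show ?thesis using un by simp
qed

context group
begin

text \<open>Turns fixed cosets into containments: all of P fixes the coset of g exactly when the
  conjugate of P by \<open>inv g\<close> lies in B. For B a Sylow subgroup this gives conjugacy, for
  B = P it gives elements normalizing P.\<close>

lemma fixed_rcoset_iff:
  assumes "subgroup B G" "g \<in> carrier G" "x \<in> carrier G"
  shows "B #> g #> x = B #> g \<longleftrightarrow> conjg G (inv g) x \<in> B"
proof -
  have B: "B \<subseteq> carrier G" using assms(1) subgroup.subset by blast
  have "B #> g #> x = B #> g \<longleftrightarrow> g \<otimes> x \<in> B #> g"
    using assms B coset_mult_assoc repr_independence[of "g \<otimes> x" B g] rcos_self[of "g \<otimes> x" B]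
    by (metis m_closed)
  also have "\<dots> \<longleftrightarrow> g \<otimes> x \<otimes> inv g \<in> B"
    using subgroup.rcos_module[OF assms(1) is_group] assms by simp
  finally show ?thesis using assms by (simp add: conjg_def)
qed

lemma dvd_card_nonfixed_rcosets:
  assumes "finite (carrier G)" "subgroup B G" "subgroup P G"
    and "Factorial_Ring.prime p" "card P = p ^ n"
  shows "p dvd card (rcosets B - {C\<in>rcosets B. \<forall>x\<in>P. C #> x = C})"
proof -
  interpret group_action "G\<lparr>carrier := P\<rparr>" "rcosets B" "\<lambda>x. \<lambda>C\<in>rcosets B. C #> inv x"
    using assms by (intro rcosets_action)
  have fin: "finite (rcosets B)" using assms(1) by (auto simp: RCOSETS_def)
  have "Coset.order (G\<lparr>carrier := P\<rparr>) = p ^ n" using assms by (simp add: Coset.order_def)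
  note dvd_card_nonfixed_points[OF assms(4) this fin]
  moreover have "(\<forall>x\<in>P. C #> inv x = C) \<longleftrightarrow> (\<forall>x\<in>P. C #> x = C)" for C
    using assms(3) by (metis inv_inv subgroup.m_inv_closed subgroup.mem_carrier)
  ultimately show ?thesis by (simp cong: conj_cong)
qed

lemma sylow_subgroup_imp_subgroup: "sylow_subgroup p G S \<Longrightarrow> subgroup S G"
  by (simp add: sylow_subgroup_def)

lemma order_pos: "finite (carrier G) \<Longrightarrow> Coset.order G > 0"
  using order_gt_0_iff_finite by blast

lemma sylow_index_not_dvd:
  assumes "finite (carrier G)" "Factorial_Ring.prime p" "sylow_subgroup p G S"
  shows "\<not> p dvd card (rcosets S)"
proof
  assume "p dvd card (rcosets S)"
  then obtain m where m: "card (rcosets S) = p * m" by blast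
  have "subgroup S G" "card S = p ^ multiplicity p (Coset.order G)"
    using assms(3) by (simp_all add: sylow_subgroup_def)
  then have "p * m * p ^ multiplicity p (Coset.order G) = Coset.order G"
    using lagrange[of S] m by simp
  then have "p ^ Suc (multiplicity p (Coset.order G)) dvd Coset.order G"
    by (metis dvd_triv_left mult.assoc mult.commute power_Suc)
  moreover have "\<not> is_unit p" using assms(2) not_prime_unit by blast
  ultimately have "Suc (multiplicity p (Coset.order G)) \<le> multiplicity p (Coset.order G)"
    using order_pos[OF assms(1)] by (intro multiplicity_geI) auto
  then show False by simp
qed

lemma sylow_exists:
  assumes "finite (carrier G)" "Factorial_Ring.prime p"
  shows "\<exists>S. sylow_subgroup p G S"
proof -
  have "p ^ multiplicity p (Coset.order G) dvd Coset.order G" by (rule multiplicity_dvd)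
  then obtain m where "Coset.order G = p ^ multiplicity p (Coset.order G) * m" by blast
  then show ?thesis
    using sylow_thm[OF assms(2) is_group _ assms(1)] unfolding sylow_subgroup_def by blast
qed

lemma sylow_conj:
  assumes "finite (carrier G)" "Factorial_Ring.prime p" "sylow_subgroup p G S"
    and "subgroup P G" "card P = p ^ n"
  obtains g where "g \<in> carrier G" "conjg G g ` P \<subseteq> S"
proof -
  have S: "subgroup S G" using assms(3) by (simp add: sylow_subgroup_def)
  define F where "F = {C\<in>rcosets S. \<forall>x\<in>P. C #> x = C}"
  \<comment> \<open>Without a fixed coset, p would divide the index of a Sylow subgroup.\<close>
  have "F \<noteq> {}"
  proof
    assume "F = {}"
    then have "p dvd card (rcosets S)"
      using dvd_card_nonfixed_rcosets[OF assms(1) S assms(4,2,5), folded F_def] by simp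
    then show False using sylow_index_not_dvd[OF assms(1-3)] by blast
  qed
  then obtain g where g: "g \<in> carrier G" "\<And>x. x \<in> P \<Longrightarrow> S #> g #> x = S #> g"
    by (auto simp: F_def RCOSETS_def)
  then have "conjg G (inv g) ` P \<subseteq> S"
    using fixed_rcoset_iff[OF S g(1)] assms(4) subgroup.mem_carrier by fastforce
  then show ?thesis using that[OF inv_closed[OF g(1)]] by blast
qed

lemma sylow_conj_in:
  assumes "finite (carrier G)" "Factorial_Ring.prime p" "subgroup K G"
    and "sylow_subgroup p (G\<lparr>carrier := K\<rparr>) S" "subgroup P G" "P \<subseteq> K" "card P = p ^ n"
  obtains g where "g \<in> K" "conjg G g ` P \<subseteq> S"
proof -
  interpret K: group "G\<lparr>carrier := K\<rparr>" using assms(3) by (rule subgroup_imp_group)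
  have "finite K" using assms finite_subgroup by blast
  moreover have "subgroup P (G\<lparr>carrier := K\<rparr>)" using assms subgroup_incl by blast
  ultimately obtain g where "g \<in> K" "conjg (G\<lparr>carrier := K\<rparr>) g ` P \<subseteq> S"
    using K.sylow_conj[OF _ assms(2,4) _ assms(7)] by auto
  then show ?thesis using that assms(3) by simp
qed

section \<open>Normalizers and chains of subgroups in p-groups\<close>

lemma normalizer_growth:
  assumes "finite (carrier G)" "Factorial_Ring.prime p" "subgroup S G" "card S = p ^ n"
    and "subgroup P G" "P \<subset> S"
  obtains g where "g \<in> S" "g \<notin> P" "conjg G g ` P = P"
proof -
  interpret S: group "G\<lparr>carrier := S\<rparr>" using assms(3) by (rule subgroup_imp_group)
  have finS: "finite S" using assms finite_subgroup by blast
  have PS: "subgroup P (G\<lparr>carrier := S\<rparr>)" using assms subgroup_incl by blast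
  define Y where "Y = rcosets\<^bsub>G\<lparr>carrier := S\<rparr>\<^esub> P"
  define F where "F = {C\<in>Y. \<forall>x\<in>P. C #> x = C}"
  have lag: "card Y * card P = p ^ n"
    using S.lagrange[OF PS] assms(4) by (simp add: Coset.order_def Y_def)
  then obtain k where k: "card P = p ^ k"
    using divides_primepow_nat[OF assms(2)] by (metis dvd_triv_right)
  have "card P < card S" using assms(6) finS by (simp add: psubset_card_mono)
  then have "card Y \<noteq> 1" using lag assms(4) by auto
  moreover obtain j where j: "card Y = p ^ j"
    using lag divides_primepow_nat[OF assms(2)] by (metis dvd_triv_left)
  ultimately have pY: "p dvd card Y" by (cases j) auto
  have finY: "finite Y" unfolding Y_def using finS by (auto simp: RCOSETS_def)
  have FY: "F \<subseteq> Y" by (auto simp: F_def)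
  have "p dvd card (Y - F)"
    using S.dvd_card_nonfixed_rcosets[OF _ PS PS assms(2) k] finS by (simp add: Y_def F_def)
  moreover have "card Y = card (Y - F) + card F"
    using card_Diff_subset[OF rev_finite_subset[OF finY FY] FY] card_mono[OF finY FY] by linarith
  ultimately have pF: "p dvd card F" using pY by (metis dvd_add_right_iff)
  have P: "P \<subseteq> carrier G" using assms subgroup.subset by blast
  \<comment> \<open>The coset P is fixed by P. Since p divides the number of fixed cosets there is a
    second one, and the inverse of its representative is an element outside P that normalizes
    P.\<close>
  have "P #> x = P" if "x \<in> P" for x using coset_join2[OF _ assms(5) that] that P by blast
  moreover have "P \<in> Y" unfolding Y_def using S.subgroup_self PS
    using subgroup.subgroup_in_rcosets[OF PS S.is_group] by blast
  ultimately have PF: "P \<in> F" by (auto simp: F_def)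
  have "F \<noteq> {P}"
  proof
    assume "F = {P}"
    then have "p dvd 1" using pF by simp
    then show False using assms(2) by (simp add: prime_gt_1_nat)
  qed
  then obtain C where C: "C \<in> F" "C \<noteq> P" using PF by blast
  then obtain g where g: "g \<in> S" "C = P #> g" by (fastforce simp: F_def Y_def RCOSETS_def)
  have gG: "g \<in> carrier G" by (rule subgroup.mem_carrier[OF assms(3) g(1)])
  have "g \<notin> P" using C(2) g(2) coset_join2[OF gG assms(5)] by blast
  then have "inv g \<in> S" "inv g \<notin> P" using g assms(3,5) gG
    by (metis inv_inv subgroup.m_inv_closed)+
  moreover have "conjg G (inv g) ` P \<subseteq> P"
    using C g gG fixed_rcoset_iff[OF assms(5) gG] P by (auto simp: F_def)
  then have "conjg G (inv g) ` P = P"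
    by (rule conjg_subset_imp_eq[OF rev_finite_subset[OF assms(1) P] inv_closed[OF gG] P])
  ultimately show ?thesis by (rule that)
qed

lemma p_subgroup_step:
  assumes "finite (carrier G)" "Factorial_Ring.prime p" "subgroup S G" "card S = p ^ n"
    and "subgroup P G" "P \<subset> S"
  shows "\<exists>Q. subgroup Q G \<and> P \<subseteq> Q \<and> Q \<subseteq> S \<and> card Q = p * card P"
proof -
  define N where "N = normalizer G P \<inter> S"
  have P: "P \<subseteq> carrier G" using assms subgroup.subset by blast
  have N: "subgroup N G" unfolding N_def
    using subgroups_Inter_pair normalizer_imp_subgroup[OF P] assms(3) by blast
  have PN: "P \<subseteq> N" using subgroup_subset_normalizer[OF assms(5)] assms(6) by (auto simp: N_def)
  obtain g where g: "g \<in> S" "g \<notin> P" "conjg G g ` P = P" using normalizer_growth[OF assms] .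
  then have "g \<in> N" using P subgroup.mem_carrier[OF assms(3)] by (simp add: N_def mem_normalizer)
  then have "P \<noteq> N" using g(2) by blast
  have nor: "P \<lhd> G\<lparr>carrier := N\<rparr>"
    unfolding normal_consistent_iff[OF N] using assms(5) PN by (auto simp: N_def mem_normalizer[OF P]) (metis imageI)
  interpret N: group "G\<lparr>carrier := N\<rparr>" using N by (rule subgroup_imp_group)
  interpret nor: normal P "G\<lparr>carrier := N\<rparr>" by (rule nor)
  have finN: "finite N" using assms(1) N finite_subgroup by blast
  have lagN: "card (rcosets\<^bsub>G\<lparr>carrier := N\<rparr>\<^esub> P) * card P = card N"
    using N.lagrange[OF nor.subgroup_axioms] by (simp add: Coset.order_def)
  have "subgroup N (G\<lparr>carrier := S\<rparr>)" using N assms(3) by (auto simp: subgroup_consistent_iff N_def)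
  then have "card N dvd p ^ n"
    using group.lagrange[OF subgroup_imp_group[OF assms(3)]] assms(4)
    by (metis Coset.order_def dvd_triv_right partial_object.select_convs(1) partial_object.update_convs(1) partial_object.surjective)
  then have "card (rcosets\<^bsub>G\<lparr>carrier := N\<rparr>\<^esub> P) dvd p ^ n"
    using lagN by (metis dvd_mult_left)
  then obtain k where k: "card (rcosets\<^bsub>G\<lparr>carrier := N\<rparr>\<^esub> P) = p ^ k"
    using divides_primepow_nat[OF assms(2)] by blast
  have "card P < card N" using PN \<open>P \<noteq> N\<close> finN by (simp add: psubset_card_mono psubsetI)
  then have "k \<noteq> 0" using k lagN by (cases k) auto
  \<comment> \<open>Only one factor p is split off: \<open>sylow_thm\<close> does not ask the
    cofactor to be prime to p, so it yields a subgroup of order p in the quotient, whose preimage is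
    the union of its cosets.\<close>
  then have ord: "Coset.order (G\<lparr>carrier := N\<rparr> Mod P) = p ^ 1 * p ^ (k - 1)"
    using k by (simp add: Coset.order_def FactGroup_def flip: power_Suc)
  have "finite (carrier (G\<lparr>carrier := N\<rparr> Mod P))"
    using finN by (simp add: carrier_FactGroup)
  from sylow_thm[OF assms(2) nor.factorgroup_is_group ord this]
  obtain A where A: "subgroup A (G\<lparr>carrier := N\<rparr> Mod P)" "card A = p" by auto
  have Q: "subgroup (\<Union>A) (G\<lparr>carrier := N\<rparr>)" by (rule nor.factgroup_subgroup_union_subgroup[OF A(1)])
  then have QG: "subgroup (\<Union>A) G" "\<Union>A \<subseteq> N" using subgroup_consistent_iff[OF N] by auto
  have "P \<in> A" using subgroup.one_closed[OF A(1)] by simp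
  then have PQ: "P \<subseteq> \<Union>A" by blast
  have "A = rcosets\<^bsub>G\<lparr>carrier := \<Union>A\<rparr>\<^esub> P"
    using nor.factgroup_subgroup_union_factor[OF A(1)] by simp
  then have "card A * card P = card (\<Union>A)"
    using group.lagrange[OF subgroup_imp_group[OF QG(1)], of P] subgroup_incl[OF assms(5) QG(1) PQ]
    by (simp add: Coset.order_def)
  then show ?thesis using QG PQ A(2) by (intro exI[of _ "\<Union>A"]) (auto simp: N_def)
qed

text \<open>Used twice: to enlarge Q to an abelian subgroup of order p|D|, and to find inside Q a
  subgroup of order |D|, starting from the trivial group.\<close>

lemma p_subgroup_extend:
  assumes "finite (carrier G)" "Factorial_Ring.prime p" "subgroup S G" "card S = p ^ n"
    and "b \<le> n" "subgroup P G" "P \<subseteq> S" "card P = p ^ a" "a \<le> b"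
  shows "\<exists>Q. subgroup Q G \<and> P \<subseteq> Q \<and> Q \<subseteq> S \<and> card Q = p ^ b"
  using assms(9,5)
proof (induction b rule: dec_induct)
  case (step b)
  then obtain Q where Q: "subgroup Q G" "P \<subseteq> Q" "Q \<subseteq> S" "card Q = p ^ b" by auto
  have "p ^ b < p ^ n" using step assms(2) prime_gt_1_nat by auto
  then have "Q \<subset> S" using Q assms(4) by auto
  from p_subgroup_step[OF assms(1-4) Q(1) this] Q show ?case by (metis order_trans power_Suc)
qed (use assms in blast)

lemma p_subgroup_card:
  assumes "finite (carrier G)" "Factorial_Ring.prime p" "subgroup S G" "card S = p ^ n"
    and "subgroup P G" "P \<subseteq> S"
  shows "\<exists>a\<le>n. card P = p ^ a"
proof -
  have "card P dvd p ^ n"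
    using group.lagrange[OF subgroup_imp_group[OF assms(3)] subgroup_incl[OF assms(5,3,6)]] assms(4)
    by (simp add: Coset.order_def) (metis dvd_triv_right)
  then show ?thesis using divides_primepow_nat[OF assms(2)] by blast
qed

section \<open>Sylow subgroups of normal subgroups and the Frattini argument\<close>

lemma sylow_card_eq:
  assumes "subgroup K G" "sylow_subgroup p (G\<lparr>carrier := K\<rparr>) S" "subgroup T G" "T \<subseteq> K" "card T = card S"
  shows "sylow_subgroup p (G\<lparr>carrier := K\<rparr>) T"
  using assms by (simp add: sylow_subgroup_def subgroup_incl)

text \<open>A Sylow subgroup of N can be conjugated by an element of K into R, and it stays in N by
  normality; conversely R \<inter> N is a p-subgroup of N. Comparing orders both ways gives
  equality.\<close>

lemma sylow_Int_normal:
  assumes "finite (carrier G)" "Factorial_Ring.prime p" "subgroup K G"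
    and "sylow_subgroup p (G\<lparr>carrier := K\<rparr>) R" "N \<lhd> G\<lparr>carrier := K\<rparr>"
  shows "sylow_subgroup p (G\<lparr>carrier := N\<rparr>) (R \<inter> N)"
proof -
  have N: "subgroup N G" "N \<subseteq> K" "\<And>g x. \<lbrakk>g \<in> K; x \<in> N\<rbrakk> \<Longrightarrow> conjg G g x \<in> N"
    using assms(5) normal_consistent_iff[OF assms(3)] by auto
  have R: "subgroup R G" "R \<subseteq> K"
    using assms(4) subgroup_consistent_iff[OF assms(3)] by (auto simp: sylow_subgroup_def)
  interpret N: group "G\<lparr>carrier := N\<rparr>" using N(1) by (rule subgroup_imp_group)
  have finN: "finite N" using assms(1) N(1) finite_subgroup by blast
  obtain P where P: "sylow_subgroup p (G\<lparr>carrier := N\<rparr>) P"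
    using N.sylow_exists[OF _ assms(2)] finN by auto
  then obtain n where n: "card P = p ^ n" by (auto simp: sylow_subgroup_def)
  have PG: "subgroup P G" "P \<subseteq> N"
    using P subgroup_consistent_iff[OF N(1)] by (auto simp: sylow_subgroup_def)
  obtain g where g: "g \<in> K" "conjg G g ` P \<subseteq> R"
    using sylow_conj_in[OF assms(1-4) PG(1) subset_trans[OF PG(2) N(2)] n] .
  have gG: "g \<in> carrier G" by (rule subgroup.mem_carrier[OF assms(3) g(1)])
  have sub: "conjg G g ` P \<subseteq> R \<inter> N" using g N(3) PG(2) by auto
  have RN: "subgroup (R \<inter> N) G" using R N(1) subgroups_Inter_pair by blast
  have "finite (R \<inter> N)" using finN by blast
  then have le: "card P \<le> card (R \<inter> N)"
    using card_mono[OF _ sub] gG PG(1) by (simp add: subgroup.subset)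
  obtain m where m: "card (R \<inter> N) = p ^ m"
    using p_subgroup_card[OF assms(1,2) R(1) _ RN] assms(4) by (auto simp: sylow_subgroup_def)
  obtain h where h: "h \<in> N" "conjg G h ` (R \<inter> N) \<subseteq> P"
    using sylow_conj_in[OF assms(1,2) N(1) P RN Int_lower2 m] .
  have hG: "h \<in> carrier G" by (rule subgroup.mem_carrier[OF N(1) h(1)])
  have "card (R \<inter> N) \<le> card P"
    using card_mono[OF rev_finite_subset[OF finN PG(2)] h(2)] hG RN by (simp add: subgroup.subset)
  with le show ?thesis using sylow_card_eq[OF N(1) P RN] by simp
qed

lemma frattini:
  assumes "finite (carrier G)" "Factorial_Ring.prime p" "subgroup K G" "N \<lhd> G\<lparr>carrier := K\<rparr>"
    and "sylow_subgroup p (G\<lparr>carrier := N\<rparr>) R" "x \<in> K"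
  obtains c y where "c \<in> N" "y \<in> K" "y \<in> normalizer G R" "x = c \<otimes> y"
proof -
  have N: "subgroup N G" "N \<subseteq> K" "\<And>g x. \<lbrakk>g \<in> K; x \<in> N\<rbrakk> \<Longrightarrow> conjg G g x \<in> N"
    using assms(4) normal_consistent_iff[OF assms(3)] by auto
  have R: "subgroup R G" "R \<subseteq> N"
    using assms(5) subgroup_consistent_iff[OF N(1)] by (auto simp: sylow_subgroup_def)
  obtain n where n: "card R = p ^ n" using assms(5) by (auto simp: sylow_subgroup_def)
  have KG: "K \<subseteq> carrier G" and RG: "R \<subseteq> carrier G"
    using assms(3) R(1) subgroup.subset by blast+
  have xi: "inv x \<in> K" by (rule subgroup.m_inv_closed[OF assms(3,6)])
  have xG: "x \<in> carrier G" using assms(6) KG by blast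
  have "subgroup (conjg G x ` R) G" using conjg_subgroup[OF xG R(1)] .
  moreover have "conjg G x ` R \<subseteq> N" using N(3) assms(6) R(2) by blast
  moreover have "card (conjg G x ` R) = p ^ n" using n xG RG by simp
  ultimately obtain c where c: "c \<in> N" "conjg G c ` conjg G x ` R \<subseteq> R"
    using sylow_conj_in[OF assms(1,2) N(1) assms(5)] by metis
  have cG: "c \<in> carrier G" "c \<in> K" using c(1) N(2) KG by auto
  have "conjg G (x \<otimes> c) ` R = R"
    using conjg_subset_imp_eq[OF rev_finite_subset[OF assms(1) RG] m_closed[OF xG cG(1)] RG] c(2)
    by (simp only: conjg_image_mult[OF xG cG(1) RG])
  then have y: "x \<otimes> c \<in> K" "x \<otimes> c \<in> normalizer G R"
    using mem_normalizer[OF RG] xG cG assms(3,6) by (simp_all add: subgroup.m_closed)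
  \<comment> \<open>Sylow's theorem puts the correcting element on the right of x; normality of N
    moves it to the left, where it acts first. If it centralizes Q, then x and y induce the same map
    on Q.\<close>
  have "conjg G (inv x) (inv c) \<in> N" using N(1,3) c(1) xi by (simp add: subgroup.m_inv_closed)
  moreover have "x = conjg G (inv x) (inv c) \<otimes> (x \<otimes> c)"
    using xG cG by (simp add: conjg_def m_assoc)
  ultimately show ?thesis using that y by blast
qed

end

section \<open>Chief factors and the supersolvable hypercenter\<close>

text \<open>Cyclicity of H/K through a representative of a generator. As no quotient group occurs,
  generators can be moved between perspective factors by computing in G.\<close>

definition cyclic_over :: "('a, 'b) monoid_scheme \<Rightarrow> 'a set \<Rightarrow> 'a set \<Rightarrow> bool" where
  "cyclic_over G H K \<longleftrightarrow> (\<exists>x\<in>H. \<forall>y\<in>H. \<exists>n::int. y \<in> K #>\<^bsub>G\<^esub> x [^]\<^bsub>G\<^esub> n)"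

text \<open>The property maximized in \<open>supersolvable_hypercenter\<close>, with cyclicity
  expressed by \<open>cyclic_over\<close>.\<close>

definition hypercyclic :: "('a, 'b) monoid_scheme \<Rightarrow> 'a set \<Rightarrow> bool" where
  "hypercyclic G N \<longleftrightarrow> N \<lhd> G \<and> (\<forall>H K. chief_factor G H K \<and> H \<subseteq> N \<longrightarrow> cyclic_over G H K)"

lemma (in normal) cyclic_Mod_iff: "cyclic_group (G Mod H) \<longleftrightarrow> cyclic_over G (carrier G) H"
proof -
  interpret Q: group "G Mod H" by (rule factorgroup_is_group)
  have "cyclic_group (G Mod H) \<longleftrightarrow>
    (\<exists>x\<in>carrier G. carrier (G Mod H) = range (\<lambda>n::int. H #> x [^] n))"
    unfolding Q.cyclic_group by (auto simp: carrier_FactGroup FactGroup_int_pow)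
  also have "\<dots> \<longleftrightarrow> (\<exists>x\<in>carrier G. carrier (G Mod H) \<subseteq> range (\<lambda>n::int. H #> x [^] n))"
    by (intro bex_cong refl) (auto simp: carrier_FactGroup)
  also have "\<dots> \<longleftrightarrow> (\<exists>x\<in>carrier G. \<forall>y\<in>carrier G. \<exists>n::int. H #> y = H #> x [^] n)"
    by (simp add: carrier_FactGroup image_subset_iff image_iff)
  also have "\<dots> \<longleftrightarrow> cyclic_over G (carrier G) H"
    unfolding cyclic_over_def
    by (intro bex_cong ball_cong ex_cong1 refl)
       (metis int_pow_closed rcos_self repr_independence subgroup_axioms)
  finally show ?thesis .
qed

context group
begin

lemma cyclic_Mod_subgroup_iff:
  assumes "subgroup H G" "K \<lhd> G\<lparr>carrier := H\<rparr>"
  shows "cyclic_group (G\<lparr>carrier := H\<rparr> Mod K) \<longleftrightarrow> cyclic_over G H K"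
  unfolding normal.cyclic_Mod_iff[OF assms(2)] cyclic_over_def
  using int_pow_consistent[OF assms(1)] by simp

lemma normalD:
  assumes "N \<lhd> G"
  shows "subgroup N G" "N \<subseteq> carrier G" "\<one> \<in> N"
    "\<And>x y. \<lbrakk>x \<in> N; y \<in> N\<rbrakk> \<Longrightarrow> x \<otimes> y \<in> N" "\<And>x. x \<in> N \<Longrightarrow> inv x \<in> N"
    "\<And>g x. \<lbrakk>g \<in> carrier G; x \<in> N\<rbrakk> \<Longrightarrow> conjg G g x \<in> N"
  using assms unfolding normal_iff_conjg subgroup_def by auto

lemma rcoset_mem_iff:
  assumes "subgroup K G" "x \<in> carrier G" "y \<in> carrier G"
  shows "y \<in> K #> x \<longleftrightarrow> y \<otimes> inv x \<in> K"
  using subgroup.rcos_module[OF assms(1) is_group assms(2,3)] .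

lemma rcoset_eq_self_iff:
  assumes "subgroup K G" "x \<in> carrier G"
  shows "K #> x = K \<longleftrightarrow> x \<in> K"
  using assms coset_join1 coset_join2 subgroup.subset by metis

text \<open>The correspondence theorem: normal subgroups of G/K are images of normal subgroups of G
  containing K, and the preimage is the union of the cosets. Quotients thereby disappear from the
  definition of a chief factor.\<close>

lemma chief_factor_iff:
  "chief_factor G H K \<longleftrightarrow>
    H \<lhd> G \<and> K \<lhd> G \<and> K \<subset> H \<and> (\<forall>L. L \<lhd> G \<and> K \<subseteq> L \<and> L \<subseteq> H \<longrightarrow> L = K \<or> L = H)"
proof (cases "H \<lhd> G \<and> K \<lhd> G \<and> K \<subseteq> H")
  case True
  then have H: "H \<lhd> G" and K: "K \<lhd> G" and KH: "K \<subseteq> H" by auto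
  interpret K: normal K G by (rule K)
  define c where "c = (\<lambda>x. K #> x)"
  have car: "carrier (G\<lparr>carrier := L\<rparr> Mod K) = c ` L" for L
    by (simp add: carrier_FactGroup c_def)
  have norm: "c ` L \<lhd> G Mod K" if "L \<lhd> G" "K \<subseteq> L" for L
    using normality_factorization[OF K that(2,1)] car[of L] by (simp add: FactGroup_def)
  have self: "c x = K \<longleftrightarrow> x \<in> K" if "x \<in> carrier G" for x
    unfolding c_def by (rule rcoset_eq_self_iff[OF K.subgroup_axioms that])
  have triv: "c ` L = {K} \<longleftrightarrow> L = K" if "L \<lhd> G" "K \<subseteq> L" for L
  proof
    assume *: "c ` L = {K}"
    have "x \<in> K" if x: "x \<in> L" for x
      using self[of x] * x normalD(2)[OF \<open>L \<lhd> G\<close>] by blast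
    then show "L = K" using that by blast
  next
    assume "L = K"
    then have "\<And>x. x \<in> L \<Longrightarrow> c x = K" using self K.subset by blast
    moreover have "\<one> \<in> L" using normalD(3)[OF that(1)] .
    ultimately show "c ` L = {K}" by force
  qed
  have inj: "x \<in> L" if L: "L \<lhd> G" "K \<subseteq> L" "x \<in> carrier G" "c x \<in> c ` L" for x L
  proof -
    obtain l where l: "l \<in> L" "c x = c l" using L(4) by blast
    have lG: "l \<in> carrier G" using l(1) normalD(2)[OF L(1)] by blast
    have "x \<in> K #> l" using l(2) rcos_self[OF L(3) K.subgroup_axioms] by (simp add: c_def)
    then have "x \<otimes> inv l \<in> K" using rcoset_mem_iff[OF K.subgroup_axioms lG L(3)] by blast
    then have "x \<otimes> inv l \<otimes> l \<in> L" using L(2) l(1) normalD(4)[OF L(1)] by blast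
    then show "x \<in> L" using lG L(3) by (simp add: m_assoc)
  qed
  have mini: "minimal_normal (c ` H) (G Mod K) \<longleftrightarrow> c ` H \<noteq> {K} \<and>
      (\<forall>M. M \<lhd> G Mod K \<and> M \<subseteq> c ` H \<longrightarrow> M = {K} \<or> M = c ` H)"
    using norm[OF H KH] by (simp add: minimal_normal_def)
  have "minimal_normal (c ` H) (G Mod K) \<longleftrightarrow>
      H \<noteq> K \<and> (\<forall>L. L \<lhd> G \<and> K \<subseteq> L \<and> L \<subseteq> H \<longrightarrow> L = K \<or> L = H)" (is "?l \<longleftrightarrow> ?r")
  proof
    assume l: ?l
    have "L = K \<or> L = H" if L: "L \<lhd> G" "K \<subseteq> L" "L \<subseteq> H" for L
    proof -
      have "c ` L = {K} \<or> c ` L = c ` H"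
        using l[unfolded mini, THEN conjunct2, rule_format] norm[OF L(1,2)] image_mono[OF L(3), of c] by simp
      then show ?thesis
      proof
        assume "c ` L = c ` H"
        have "x \<in> L" if "x \<in> H" for x
          by (rule inj[OF L(1,2)]) (use that normalD(2)[OF H] \<open>c ` L = c ` H\<close> in auto)
        then show ?thesis using L by blast
      qed (use triv[OF L(1,2)] in blast)
    qed
    moreover have "H \<noteq> K" using l triv[OF H KH] unfolding mini by simp
    ultimately show ?r by blast
  next
    assume r: ?r
    have "M = {K} \<or> M = c ` H" if M: "M \<lhd> G Mod K" "M \<subseteq> c ` H" for M
    proof -
      have Ms: "subgroup M (G Mod K)" by (rule normal_imp_subgroup[OF M(1)])
      define L where "L = \<Union>M"
      have L: "L = {x \<in> carrier G. c x \<in> M}"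
        unfolding L_def c_def by (rule K.factgroup_subgroup_union_char[OF Ms])
      have LG: "L \<lhd> G" unfolding L_def by (rule K.factgroup_subgroup_union_normal[OF M(1)])
      have "K \<in> M" using subgroup.one_closed[OF Ms] by simp
      then have KL: "K \<subseteq> L" unfolding L_def by blast
      have LH: "L \<subseteq> H" using L M(2) inj[OF H KH] by blast
      have Mc: "M = c ` L" using L M(2) normalD(2)[OF H] by blast
      have "L = K \<or> L = H" using r LG KL LH by simp
      then show ?thesis using Mc triv[OF LG KL] by auto
    qed
    then show ?l unfolding mini using triv[OF H KH] r by simp
  qed
  then show ?thesis using True unfolding chief_factor_def car by blast
qed (auto simp: chief_factor_def)

section \<open>Perspective factors and products of hypercyclic subgroups\<close>

lemma normal_Int: "\<lbrakk>H \<lhd> G; K \<lhd> G\<rbrakk> \<Longrightarrow> H \<inter> K \<lhd> G"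
  by (rule normal_subgroup_intersect)

lemma set_mult_normal_supsets:
  assumes "H \<lhd> G" "K \<lhd> G" shows "H \<subseteq> H <#> K" "K \<subseteq> H <#> K"
proof -
  have "x \<otimes> \<one> \<in> H <#> K" if "x \<in> H" for x
    using that normalD(3)[OF assms(2)] unfolding set_mult_def by blast
  then show "H \<subseteq> H <#> K" using normalD(2)[OF assms(1)] by (metis r_one subset_iff)
  have "\<one> \<otimes> x \<in> H <#> K" if "x \<in> K" for x
    using that normalD(3)[OF assms(1)] unfolding set_mult_def by blast
  then show "K \<subseteq> H <#> K" using normalD(2)[OF assms(2)] by (metis l_one subset_iff)
qed

lemma set_mult_subset_subgroup:
  "\<lbrakk>subgroup L G; H \<subseteq> L; K \<subseteq> L\<rbrakk> \<Longrightarrow> H <#> K \<subseteq> L"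
  unfolding set_mult_def by (auto intro: subgroup.m_closed)

lemma set_mult_memE:
  assumes "x \<in> H <#> K" obtains h k where "h \<in> H" "k \<in> K" "x = h \<otimes> k"
  using assms unfolding set_mult_def by blast

text \<open>Perspective factors H/K and H'/K' are isomorphic as G-groups, so being chief and being cyclic
  transfer in both directions. This makes a product of hypercyclic normal subgroups hypercyclic, hence
  the supersolvable hypercenter a genuine greatest element rather than a junk value.\<close>
context
  fixes H K H' K'
  assumes nrm: "K \<lhd> G" "H' \<lhd> G"
    and H: "H = K <#> H'" and K': "K' = K \<inter> H'"
begin

private lemma nrm': "H \<lhd> G" "K' \<lhd> G" "K \<subseteq> H" "H' \<subseteq> H" "K' \<subseteq> K" "K' \<subseteq> H'"
  using nrm H K' normal_subgroup_set_mult_closed normal_Int set_mult_normal_supsets by auto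

text \<open>Dedekind's modular law elementwise: for L inside M, an element of KL that lies in M is
  already in (K \<inter> M)L.\<close>

private lemma quotE:
  assumes "x \<in> K <#> L" "x \<in> M" "L \<subseteq> M" "M \<lhd> G"
  obtains k l where "k \<in> K" "k \<in> M" "l \<in> L" "x = k \<otimes> l"
proof -
  obtain k l where kl: "k \<in> K" "l \<in> L" "x = k \<otimes> l" using assms(1) by (rule set_mult_memE)
  have "k \<in> carrier G" "l \<in> carrier G" using kl normalD(2)[OF nrm(1)] normalD(2)[OF assms(4)] assms(3) by auto
  then have "k = x \<otimes> inv l" using kl by (simp add: m_assoc)
  moreover have "l \<in> M" using kl assms(3) by blast
  ultimately have "k \<in> M" using assms(2) normalD(4,5)[OF assms(4)] by simp
  then show ?thesis using kl that by blast
qed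

lemma perspective_chief_down:
  assumes "chief_factor G H K" shows "chief_factor G H' K'"
proof -
  have min: "L = K \<or> L = H" if "L \<lhd> G" "K \<subseteq> L" "L \<subseteq> H" for L
    using assms that unfolding chief_factor_iff by blast
  have "L = K' \<or> L = H'" if L: "L \<lhd> G" "K' \<subseteq> L" "L \<subseteq> H'" for L
  proof -
    \<comment> \<open>\<open>L\<close> is tested through \<open>K <#> L\<close>, which lies between
      K and H. If this is K, then L lies in K \<inter> H'; if it is H, the modular law gives back
      all of H'.\<close>
    have "K <#> L = K \<or> K <#> L = H"
      using min[OF normal_subgroup_set_mult_closed[OF nrm(1) L(1)]] set_mult_normal_supsets[OF nrm(1) L(1)]
        mono_set_mult[OF subset_refl[of K] L(3), of G] H by simp
    then show ?thesis
    proof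
      assume "K <#> L = K"
      then have "L \<subseteq> K" using set_mult_normal_supsets[OF nrm(1) L(1)] by simp
      then show ?thesis using L K' by blast
    next
      assume *: "K <#> L = H"
      have "H' \<subseteq> L"
      proof
        fix x assume x: "x \<in> H'"
        then have "x \<in> K <#> L" using * nrm'(4) by blast
        then obtain k l where kl: "k \<in> K" "k \<in> H'" "l \<in> L" "x = k \<otimes> l"
          using quotE[OF _ x L(3) nrm(2)] by blast
        then have "k \<in> L" using K' L(2) by blast
        then show "x \<in> L" using kl normalD(4)[OF L(1)] by blast
      qed
      then show ?thesis using L by blast
    qed
  qed
  moreover have "K' \<noteq> H'"
  proof
    assume "K' = H'"
    then have "H' \<subseteq> K" using K' by blast
    then have "H \<subseteq> K" unfolding H by (intro set_mult_subset_subgroup normalD(1)[OF nrm(1)]) auto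
    then show False using assms unfolding chief_factor_iff by blast
  qed
  ultimately show ?thesis unfolding chief_factor_iff using nrm nrm' by blast
qed

lemma perspective_chief_up:
  assumes "chief_factor G H' K'" shows "chief_factor G H K"
proof -
  have min: "L = K' \<or> L = H'" if "L \<lhd> G" "K' \<subseteq> L" "L \<subseteq> H'" for L
    using assms that unfolding chief_factor_iff by blast
  have "L = K \<or> L = H" if L: "L \<lhd> G" "K \<subseteq> L" "L \<subseteq> H" for L
  proof -
    \<comment> \<open>The opposite passage: intersecting with H' sends subgroups between K and H to
      subgroups between K' and H'.\<close>
    have "L \<inter> H' = K' \<or> L \<inter> H' = H'"
      using min[OF normal_Int[OF L(1) nrm(2)]] K' L(2) by blast
    then show ?thesis
    proof
      assume *: "L \<inter> H' = K'"
      have "L \<subseteq> K"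
      proof
        fix x assume x: "x \<in> L"
        then have "x \<in> K <#> H'" using L(3) H by blast
        then obtain k h where kh: "k \<in> K" "h \<in> H'" "x = k \<otimes> h" by (rule set_mult_memE)
        have "k \<in> carrier G" "h \<in> carrier G" using kh normalD(2)[OF nrm(1)] normalD(2)[OF nrm(2)] by auto
        then have "h = inv k \<otimes> x" using kh by simp
        moreover have "inv k \<in> L" using kh(1) L(2) normalD(5)[OF nrm(1)] by blast
        ultimately have "h \<in> L" using x normalD(4)[OF L(1)] by simp
        then have "h \<in> K" using kh(2) * K' by blast
        then show "x \<in> K" using kh normalD(4)[OF nrm(1)] by simp
      qed
      then show ?thesis using L by blast
    next
      assume "L \<inter> H' = H'"
      then have "H \<subseteq> L" unfolding H using L by (intro set_mult_subset_subgroup normalD(1)[OF L(1)]) auto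
      then show ?thesis using L by blast
    qed
  qed
  moreover have "K \<noteq> H"
  proof
    assume "K = H"
    then have "H' = K'" using K' nrm' by blast
    then show False using assms unfolding chief_factor_iff by blast
  qed
  ultimately show ?thesis unfolding chief_factor_iff using nrm nrm' by blast
qed

lemma perspective_cyclic_up:
  assumes "cyclic_over G H' K'" shows "cyclic_over G H K"
proof -
  obtain x where x: "x \<in> H'" "\<And>y. y \<in> H' \<Longrightarrow> \<exists>n::int. y \<in> K' #> x [^] n"
    using assms unfolding cyclic_over_def by blast
  have xG: "x \<in> carrier G" using x(1) normalD(2)[OF nrm(2)] by blast
  have "\<exists>n::int. y \<in> K #> x [^] n" if "y \<in> H" for y
  proof -
    have "y \<in> K <#> H'" using that H by blast
    then obtain k h where kh: "k \<in> K" "h \<in> H'" "y = k \<otimes> h" by (rule set_mult_memE)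
    have c: "k \<in> carrier G" "h \<in> carrier G" using kh normalD(2)[OF nrm(1)] normalD(2)[OF nrm(2)] by auto
    obtain n :: int where "h \<in> K' #> x [^] n" using x(2)[OF kh(2)] by blast
    then have "h \<otimes> inv (x [^] n) \<in> K'"
      using rcoset_mem_iff[OF normalD(1)[OF nrm'(2)] _ c(2)] xG by simp
    then have "k \<otimes> (h \<otimes> inv (x [^] n)) \<in> K" using kh(1) nrm'(5) normalD(4)[OF nrm(1)] by blast
    then have "y \<otimes> inv (x [^] n) \<in> K" using kh(3) c xG by (simp add: m_assoc)
    then have "y \<in> K #> x [^] n"
      using rcoset_mem_iff[OF normalD(1)[OF nrm(1)]] xG c kh(3) by simp
    then show ?thesis ..
  qed
  then show ?thesis unfolding cyclic_over_def using x(1) nrm'(4) by blast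
qed

lemma perspective_cyclic_down:
  assumes "cyclic_over G H K" shows "cyclic_over G H' K'"
proof -
  interpret K: normal K G by (rule nrm(1))
  obtain x where x: "x \<in> H" "\<And>y. y \<in> H \<Longrightarrow> \<exists>n::int. y \<in> K #> x [^] n"
    using assms unfolding cyclic_over_def by blast
  have "x \<in> K <#> H'" using x(1) H by blast
  then obtain k z where kz: "k \<in> K" "z \<in> H'" "x = k \<otimes> z" by (rule set_mult_memE)
  have c: "k \<in> carrier G" "z \<in> carrier G" "x \<in> carrier G"
    using kz normalD(2)[OF nrm(1)] normalD(2)[OF nrm(2)] by auto
  have "x \<in> K #> z" using kz c rcoset_mem_iff[OF K.subgroup_axioms c(2,3)] by (simp add: m_assoc)
  \<comment> \<open>The component z of the generator x in H' has the same coset modulo K, hence so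
    do all powers; thus z generates the lower factor.\<close>
  then have xz: "K #> x = K #> z" using repr_independence[OF _ c(2) K.subgroup_axioms] by simp
  have pow: "K #> x [^] n = K #> z [^] n" for n :: int
    using K.FactGroup_int_pow[OF c(3), of n] K.FactGroup_int_pow[OF c(2), of n] xz by simp
  have "\<exists>n::int. y \<in> K' #> z [^] n" if y: "y \<in> H'" for y
  proof -
    have yG: "y \<in> carrier G" using y normalD(2)[OF nrm(2)] by blast
    obtain n :: int where "y \<in> K #> x [^] n" using x(2) y nrm'(4) by blast
    then have "y \<otimes> inv (z [^] n) \<in> K"
      using pow rcoset_mem_iff[OF K.subgroup_axioms _ yG] c by simp
    moreover have "z [^] n \<in> H'"
      using subgroup_int_pow_closed[OF normalD(1)[OF nrm(2)] kz(2)] .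
    then have "y \<otimes> inv (z [^] n) \<in> H'" using y normalD(4,5)[OF nrm(2)] by blast
    ultimately have "y \<in> K' #> z [^] n"
      using rcoset_mem_iff[OF normalD(1)[OF nrm'(2)] _ yG] c K' by simp
    then show ?thesis ..
  qed
  then show ?thesis unfolding cyclic_over_def using kz(2) by blast
qed

end

text \<open>If H \<inter> M is not inside K, then H = K(H \<inter> M) and the factor is perspective
  to one below M. Otherwise H/K is perspective to MH/MK; since MH lies in MN, this in turn is
  perspective to a factor below N, and cyclicity is carried back along both links.\<close>

lemma hypercyclic_set_mult:
  assumes M: "hypercyclic G M" and N: "hypercyclic G N"
  shows "hypercyclic G (M <#> N)"
  unfolding hypercyclic_def
proof (intro conjI allI impI; (elim conjE)?)
  have Mn: "M \<lhd> G" and Nn: "N \<lhd> G" using M N unfolding hypercyclic_def by auto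
  show "M <#> N \<lhd> G" by (rule normal_subgroup_set_mult_closed[OF Mn Nn])
  fix H K assume ch: "chief_factor G H K" and sub: "H \<subseteq> M <#> N"
  have Hn: "H \<lhd> G" and Kn: "K \<lhd> G" and KH: "K \<subseteq> H"
    and min: "\<And>L. L \<lhd> G \<Longrightarrow> K \<subseteq> L \<Longrightarrow> L \<subseteq> H \<Longrightarrow> L = K \<or> L = H"
    using ch unfolding chief_factor_iff by auto
  show "cyclic_over G H K"
  proof (cases "H \<inter> M \<subseteq> K")
    case False
    have HM: "H \<inter> M \<lhd> G" by (rule normal_Int[OF Hn Mn])
    have "K <#> (H \<inter> M) = K \<or> K <#> (H \<inter> M) = H"
      using set_mult_normal_supsets[OF Kn HM]
      by (intro min normal_subgroup_set_mult_closed Kn HM set_mult_subset_subgroup normalD(1)[OF Hn] KH) auto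
    moreover have "K <#> (H \<inter> M) \<noteq> K" using False set_mult_normal_supsets[OF Kn HM] by blast
    ultimately have eq: "H = K <#> (H \<inter> M)" by simp
    have "chief_factor G (H \<inter> M) (K \<inter> (H \<inter> M))"
      by (rule perspective_chief_down[OF Kn HM eq refl ch])
    then have "cyclic_over G (H \<inter> M) (K \<inter> (H \<inter> M))" using M unfolding hypercyclic_def by blast
    then show ?thesis by (rule perspective_cyclic_up[OF Kn HM eq refl])
  next
    case True
    define K1 where "K1 = M <#> K"
    define H1 where "H1 = M <#> H"
    have K1n: "K1 \<lhd> G" and H1n: "H1 \<lhd> G"
      unfolding K1_def H1_def by (intro normal_subgroup_set_mult_closed Mn Hn Kn)+
    have sup: "M \<subseteq> K1" "K \<subseteq> K1" "M \<subseteq> H1" "H \<subseteq> H1"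
      unfolding K1_def H1_def by (intro set_mult_normal_supsets Mn Hn Kn)+
    have K1H1: "K1 \<subseteq> H1" unfolding K1_def H1_def by (rule mono_set_mult[OF subset_refl KH])
    have eq1: "H1 = K1 <#> H"
    proof
      show "H1 \<subseteq> K1 <#> H" unfolding H1_def by (rule mono_set_mult[OF sup(1) subset_refl])
      show "K1 <#> H \<subseteq> H1" by (rule set_mult_subset_subgroup[OF normalD(1)[OF H1n] K1H1 sup(4)])
    qed
    \<comment> \<open>The case assumption enters here: the component in M of an element of MK
      \<inter> H lies in H \<inter> M, hence in K.\<close>
    have eq2: "K = K1 \<inter> H"
    proof
      show "K \<subseteq> K1 \<inter> H" using sup KH by blast
      show "K1 \<inter> H \<subseteq> K"
      proof
        fix x assume x: "x \<in> K1 \<inter> H"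
        then have "x \<in> M <#> K" by (simp add: K1_def)
        then obtain m k where mk: "m \<in> M" "k \<in> K" "x = m \<otimes> k" by (rule set_mult_memE)
        have "m \<in> carrier G" "k \<in> carrier G" using mk normalD(2)[OF Mn] normalD(2)[OF Kn] by auto
        then have "m = x \<otimes> inv k" using mk by (simp add: m_assoc)
        then have "m \<in> H" using x mk(2) KH normalD(4,5)[OF Hn] by blast
        then have "m \<in> K" using mk(1) True by blast
        then show "x \<in> K" using mk normalD(4)[OF Kn] by simp
      qed
    qed
    have ch1: "chief_factor G H1 K1" by (rule perspective_chief_up[OF K1n Hn eq1 eq2 ch])
    define H2 where "H2 = H1 \<inter> N"
    have H2n: "H2 \<lhd> G" unfolding H2_def by (rule normal_Int[OF H1n Nn])
    have H1sub: "H1 \<subseteq> M <#> N"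
      unfolding H1_def
      by (intro set_mult_subset_subgroup normalD(1)[OF normal_subgroup_set_mult_closed[OF Mn Nn]]
          set_mult_normal_supsets Mn Nn sub)
    have eq3: "H1 = K1 <#> H2"
    proof
      show "K1 <#> H2 \<subseteq> H1"
        by (rule set_mult_subset_subgroup[OF normalD(1)[OF H1n] K1H1]) (simp add: H2_def)
      show "H1 \<subseteq> K1 <#> H2"
      proof
        fix x assume x: "x \<in> H1"
        then have "x \<in> M <#> N" using H1sub by blast
        then obtain m n where mn: "m \<in> M" "n \<in> N" "x = m \<otimes> n" by (rule set_mult_memE)
        have "m \<in> carrier G" "n \<in> carrier G" using mn normalD(2)[OF Mn] normalD(2)[OF Nn] by auto
        then have "n = inv m \<otimes> x" using mn by simp
        moreover have "inv m \<in> H1" using mn(1) sup normalD(5)[OF Mn] by blast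
        ultimately have "n \<in> H2" using x mn(2) normalD(4)[OF H1n] by (simp add: H2_def)
        moreover have "m \<in> K1" using mn(1) sup by blast
        ultimately show "x \<in> K1 <#> H2" unfolding set_mult_def using mn(3) by blast
      qed
    qed
    have "chief_factor G H2 (K1 \<inter> H2)" by (rule perspective_chief_down[OF K1n H2n eq3 refl ch1])
    then have "cyclic_over G H2 (K1 \<inter> H2)" using N unfolding hypercyclic_def H2_def by blast
    then have "cyclic_over G H1 K1" by (rule perspective_cyclic_up[OF K1n H2n eq3 refl])
    then show ?thesis by (rule perspective_cyclic_down[OF K1n Hn eq1 eq2])
  qed
qed

lemma hypercyclic_alt:
  "hypercyclic G N \<longleftrightarrow> N \<lhd> G \<and>
    (\<forall>H K. chief_factor G H K \<and> H \<subseteq> N \<longrightarrow> cyclic_group (G\<lparr>carrier := H\<rparr> Mod K))"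
proof -
  have "cyclic_group (G\<lparr>carrier := H\<rparr> Mod K) \<longleftrightarrow> cyclic_over G H K" if "chief_factor G H K" for H K
  proof (rule cyclic_Mod_subgroup_iff)
    have *: "H \<lhd> G" "K \<lhd> G" "K \<subseteq> H" using that unfolding chief_factor_iff by auto
    then show "subgroup H G" by (simp add: normalD)
    then show "K \<lhd> G\<lparr>carrier := H\<rparr>" using * by (simp add: normal_restrict_supergroup)
  qed
  then show ?thesis unfolding hypercyclic_def by blast
qed

lemma hypercyclic_trivial: "hypercyclic G {\<one>}"
  unfolding hypercyclic_def
proof (intro conjI allI impI)
  fix H K assume "chief_factor G H K \<and> H \<subseteq> {\<one>}"
  then have "K \<lhd> G" "K \<subset> H" "H \<subseteq> {\<one>}" unfolding chief_factor_iff by auto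
  then show "cyclic_over G H K" using normalD(3) by blast
qed (rule one_is_normal)

lemma hypercyclic_hypercenter:
  assumes "finite (carrier G)"
  shows "hypercyclic G (supersolvable_hypercenter G)"
proof -
  have sub: "N \<subseteq> carrier G" if "hypercyclic G N" for N
    using that normalD(2) unfolding hypercyclic_def by blast
  have "finite {N. hypercyclic G N}"
    by (rule finite_subset[of _ "Pow (carrier G)"]) (use sub assms in auto)
  moreover have "{N. hypercyclic G N} \<noteq> {}" using hypercyclic_trivial by blast
  ultimately obtain N where N: "hypercyclic G N" "\<And>M. hypercyclic G M \<Longrightarrow> N \<subseteq> M \<Longrightarrow> N = M"
    using finite_has_maximal[of "{N. hypercyclic G N}"] by auto
  have "M \<subseteq> N" if M: "hypercyclic G M" for M
  proof -
    have n: "M \<lhd> G" "N \<lhd> G" using M N(1) unfolding hypercyclic_def by auto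
    have h: "hypercyclic G (M <#> N)" by (rule hypercyclic_set_mult[OF M N(1)])
    have "N = M <#> N" by (rule N(2)[OF h set_mult_normal_supsets(2)[OF n]])
    then show ?thesis using set_mult_normal_supsets(1)[OF n] by simp
  qed
  then have "supersolvable_hypercenter G = N"
    unfolding supersolvable_hypercenter_def hypercyclic_alt[symmetric]
    by (intro Greatest_equality N(1))
  then show ?thesis using N(1) by simp
qed

section \<open>Chief series and the p-core\<close>

lemma chief_series:
  assumes "finite (carrier G)" "N \<lhd> G"
  shows "\<exists>n T. T (0::nat) = {\<one>} \<and> T n = N \<and> (\<forall>i<n. chief_factor G (T (Suc i)) (T i))"
  using assms(2)
proof (induction "card N" arbitrary: N rule: less_induct)
  case less
  have finN: "finite N" using less.prems normalD(2) assms(1) finite_subset by blast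
  show ?case
  proof (cases "N = {\<one>}")
    case True
    then show ?thesis by (intro exI[of _ 0] exI[of _ "\<lambda>_. {\<one>}"]) simp
  next
    case False
    let ?S = "{L. L \<lhd> G \<and> L \<subset> N}"
    have "finite ?S" by (rule finite_subset[of _ "Pow N"]) (use finN in auto)
    moreover have "{\<one>} \<in> ?S" using False one_is_normal normalD(3)[OF less.prems] by blast
    \<comment> \<open>Maximality makes N/L the top chief factor. A series for L is prolonged at
      index \<open>Suc n\<close>, which leaves its earlier terms untouched.\<close>
    ultimately obtain L where L: "L \<in> ?S" "\<And>M. M \<in> ?S \<Longrightarrow> L \<subseteq> M \<Longrightarrow> M = L"
      using finite_has_maximal[of ?S] by (metis (no_types, lifting) empty_iff)
    then have LN: "L \<lhd> G" "L \<subset> N" by auto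
    have ch: "chief_factor G N L"
      unfolding chief_factor_iff using L(2) LN less.prems by blast
    have "card L < card N" using LN(2) finN by (simp add: psubset_card_mono)
    from less.hyps[OF this LN(1)] obtain n T where T: "T (0::nat) = {\<one>}" "T n = L"
      "\<And>i. i < n \<Longrightarrow> chief_factor G (T (Suc i)) (T i)" by blast
    define T' where "T' = T(Suc n := N)"
    have "chief_factor G (T' (Suc i)) (T' i)" if "i < Suc n" for i
      using that T ch by (cases "i = n") (auto simp: T'_def)
    moreover have "T' 0 = {\<one>}" "T' (Suc n) = N" by (simp_all add: T'_def T(1))
    ultimately show ?thesis by blast
  qed
qed

text \<open>The intersection of all conjugates of a Sylow subgroup S is the greatest normal
  p-subgroup: any normal p-subgroup has a conjugate in S, so it lies in S and, being normal, in
  every conjugate of S. This determines the value of \<open>GREATEST\<close>.\<close>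

lemma p_core_normal:
  assumes "finite (carrier G)" "Factorial_Ring.prime p"
  shows "p_core p G \<lhd> G" "\<exists>n. card (p_core p G) = p ^ n"
    "\<And>N n. \<lbrakk>N \<lhd> G; card N = p ^ n\<rbrakk> \<Longrightarrow> N \<subseteq> p_core p G"
proof -
  obtain S where S: "sylow_subgroup p G S" using sylow_exists[OF assms] by blast
  have Sg: "subgroup S G" using S by (rule sylow_subgroup_imp_subgroup)
  define N where "N = {x \<in> carrier G. \<forall>g\<in>carrier G. conjg G g x \<in> S}"
  have "subgroup N G"
  proof (rule subgroupI)
    have "conjg G g \<one> = \<one>" if "g \<in> carrier G" for g using that by (simp add: conjg_def)
    then have "\<one> \<in> N" using subgroup.one_closed[OF Sg] by (simp add: N_def)
    then show "N \<noteq> {}" by blast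
  qed (use Sg in \<open>auto simp: N_def conjg_inv conjg_hom intro: subgroup.m_closed subgroup.m_inv_closed\<close>)
  moreover have "conjg G g x \<in> N" if "g \<in> carrier G" "x \<in> N" for g x
    using that unfolding N_def by (auto simp flip: conjg_mult)
  ultimately have N: "N \<lhd> G" unfolding normal_iff_conjg by blast
  have NS: "N \<subseteq> S"
  proof
    fix x assume "x \<in> N"
    then have "x \<in> carrier G" "conjg G \<one> x \<in> S" unfolding N_def by blast+
    then show "x \<in> S" by simp
  qed
  have cardN: "\<exists>n. card N = p ^ n"
    using p_subgroup_card[OF assms Sg _ normalD(1)[OF N] NS] S by (auto simp: sylow_subgroup_def)
  have max: "M \<subseteq> N" if M: "M \<lhd> G" "card M = p ^ n" for M n
  proof -
    obtain g where g: "g \<in> carrier G" "conjg G g ` M \<subseteq> S"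
      using sylow_conj[OF assms S normalD(1)[OF M(1)] M(2)] .
    then have "M \<subseteq> S" using normal_conjg_image[OF M(1)] by simp
    then show ?thesis using normalD(2,6)[OF M(1)] unfolding N_def by blast
  qed
  have eq: "p_core p G = N"
    unfolding p_core_def by (rule Greatest_equality) (use N cardN max in auto)
  show "p_core p G \<lhd> G" "\<exists>n. card (p_core p G) = p ^ n"
    "\<And>N n. \<lbrakk>N \<lhd> G; card N = p ^ n\<rbrakk> \<Longrightarrow> N \<subseteq> p_core p G"
    using N cardN max unfolding eq by auto
qed


section \<open>Action of p-subgroups on cyclic chief factors\<close>

lemma chief_factorD:
  assumes "chief_factor G H K"
  shows "H \<lhd> G" "K \<lhd> G" "K \<subset> H" "\<And>L. \<lbrakk>L \<lhd> G; K \<subseteq> L; L \<subseteq> H\<rbrakk> \<Longrightarrow> L = K \<or> L = H"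
  using assms unfolding chief_factor_iff by auto

text \<open>Subgroups of a cyclic group are characteristic. If conjugation by g sends the generating
  coset to its m-th power, it sends every coset to its m-th power, because the exponents i and m
  commute; so t goes into the coset of t^m, which lies in F.\<close>

lemma cyclic_over_normal:
  assumes "cyclic_over G H K" "H \<lhd> G" "K \<lhd> G" "subgroup F G" "K \<subseteq> F" "F \<subseteq> H"
  shows "F \<lhd> G"
  unfolding normal_iff_conjg
proof (intro conjI ballI)
  interpret K: normal K G by (rule assms(3))
  have eqI: "K #> a = K #> b" if "a \<in> K #> b" "b \<in> carrier G" for a b
    using repr_independence[OF that K.subgroup_axioms] by simp
  fix g t assume g: "g \<in> carrier G" and t: "t \<in> F"
  obtain x where x: "x \<in> H" "\<And>y. y \<in> H \<Longrightarrow> \<exists>n::int. y \<in> K #> x [^] n"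
    using assms(1) unfolding cyclic_over_def by blast
  have c: "x \<in> carrier G" "t \<in> carrier G"
    using x(1) t assms(6) normalD(2)[OF assms(2)] by auto
  have conjK: "K #> conjg G g a = K #> conjg G g b" if "a \<in> K #> b" "b \<in> carrier G" "a \<in> carrier G" for a b
  proof -
    have "conjg G g (a \<otimes> inv b) \<in> K"
      using that g rcoset_mem_iff[OF K.subgroup_axioms] normalD(6)[OF assms(3)] by blast
    then have "conjg G g a \<otimes> inv (conjg G g b) \<in> K"
      using that g by (simp add: conjg_hom conjg_inv)
    then show ?thesis
      using that g rcoset_mem_iff[OF K.subgroup_axioms] by (intro eqI) auto
  qed
  obtain i :: int where i: "t \<in> K #> x [^] i" using x(2) t assms(6) by blast
  obtain m :: int where m: "conjg G g x \<in> K #> x [^] m"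
    using x(2) normalD(6)[OF assms(2) g x(1)] by blast
  have "K #> conjg G g t = K #> (conjg G g x) [^] i"
    using conjK[OF i] c g by (simp add: conjg_int_pow)
  also have "\<dots> = (K #> conjg G g x) [^]\<^bsub>G Mod K\<^esub> i"
    using c g by (simp add: K.FactGroup_int_pow)
  also have "\<dots> = (K #> x [^] m) [^]\<^bsub>G Mod K\<^esub> i" using eqI[OF m] c by simp
  also have "\<dots> = K #> x [^] (i * m)"
    using c by (simp add: K.FactGroup_int_pow int_pow_pow mult.commute)
  also have "\<dots> = (K #> x [^] i) [^]\<^bsub>G Mod K\<^esub> m"
    using c by (simp add: K.FactGroup_int_pow int_pow_pow)
  also have "\<dots> = (K #> t) [^]\<^bsub>G Mod K\<^esub> m" using eqI[OF i] c by simp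
  also have "\<dots> = K #> t [^] m" using c by (simp add: K.FactGroup_int_pow)
  finally have "conjg G g t \<in> K #> t [^] m"
    using rcos_self[OF conjg_closed[OF g c(2)] K.subgroup_axioms] by simp
  then have "conjg G g t \<otimes> inv (t [^] m) \<in> F"
    using rcoset_mem_iff[OF K.subgroup_axioms] c g assms(5) by auto
  moreover have "t [^] m \<in> F" by (rule subgroup_int_pow_closed[OF assms(4) t])
  ultimately have "conjg G g t \<otimes> inv (t [^] m) \<otimes> t [^] m \<in> F" by (rule subgroup.m_closed[OF assms(4)])
  then show "conjg G g t \<in> F" using c g by (simp add: m_assoc)
qed (rule assms(4))

lemma conjg_rcoset:
  assumes "K \<lhd> G" "g \<in> carrier G" "t \<in> carrier G"
  shows "conjg G g ` (K #> t) = K #> conjg G g t"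
proof -
  have "conjg G g ` (K #> t) = (\<lambda>k. conjg G g (k \<otimes> t)) ` K" unfolding r_coset_def by auto
  also have "\<dots> = (\<lambda>k. conjg G g k \<otimes> conjg G g t) ` K"
    using assms normalD(2)[OF assms(1)] by (intro image_cong refl conjg_hom) auto
  also have "\<dots> = (\<lambda>k. k \<otimes> conjg G g t) ` conjg G g ` K" by (simp add: image_image)
  also have "\<dots> = K #> conjg G g t"
    unfolding normal_conjg_image[OF assms(1,2)] r_coset_def by auto
  finally show ?thesis .
qed

text \<open>As for cosets, the inverse turns conjugation from the right into an action by
  composition. E will be the set of cosets of K in H.\<close>

lemma conjg_action:
  assumes "subgroup R G" "\<And>C. C \<in> E \<Longrightarrow> C \<subseteq> carrier G"
    and "\<And>r C. r \<in> R \<Longrightarrow> C \<in> E \<Longrightarrow> conjg G r ` C \<in> E"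
  shows "group_action (G\<lparr>carrier := R\<rparr>) E (\<lambda>r. \<lambda>C\<in>E. conjg G (inv r) ` C)"
proof -
  interpret R: group "G\<lparr>carrier := R\<rparr>" using assms(1) by (rule subgroup_imp_group)
  have RG: "r \<in> carrier G" if "r \<in> R" for r by (rule subgroup.mem_carrier[OF assms(1) that])
  have Ri: "inv r \<in> R" if "r \<in> R" for r by (rule subgroup.m_inv_closed[OF assms(1) that])
  have canc: "conjg G (inv r) ` conjg G r ` C = C" "conjg G r ` conjg G (inv r) ` C = C"
    if "r \<in> R" "C \<in> E" for r C
    using RG[OF that(1)] assms(2)[OF that(2)] by (simp_all flip: conjg_image_mult)
  have bij: "(\<lambda>C\<in>E. conjg G (inv r) ` C) \<in> Bij E" if r: "r \<in> R" for r
  proof -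
    have "bij_betw (\<lambda>C. conjg G (inv r) ` C) E E"
      by (rule bij_betw_byWitness[where f' = "\<lambda>C. conjg G r ` C"])
         (use canc[OF r] assms(3)[OF r] assms(3)[OF Ri[OF r]] in auto)
    then show ?thesis by (simp add: Bij_def bij_betw_restrict_eq)
  qed
  have "(\<lambda>C\<in>E. conjg G (inv (r \<otimes> s)) ` C)
      = compose E (\<lambda>C\<in>E. conjg G (inv r) ` C) (\<lambda>C\<in>E. conjg G (inv s) ` C)" if "r \<in> R" "s \<in> R" for r s
  proof (rule ext)
    fix C
    show "(\<lambda>C\<in>E. conjg G (inv (r \<otimes> s)) ` C) C
      = compose E (\<lambda>C\<in>E. conjg G (inv r) ` C) (\<lambda>C\<in>E. conjg G (inv s) ` C) C"
    proof (cases "C \<in> E")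
      case True
      have "conjg G (inv (r \<otimes> s)) ` C = conjg G (inv r) ` conjg G (inv s) ` C"
        using that RG assms(2)[OF True] by (simp add: inv_mult_group conjg_image_mult)
      then show ?thesis using True assms(3)[OF Ri[OF that(2)] True] by (simp add: compose_def)
    qed (simp add: compose_def)
  qed
  then show ?thesis
    unfolding group_action_def group_hom_def group_hom_axioms_def
    using bij R.is_group group_BijGroup by (auto simp: hom_def BijGroup_def)
qed

text \<open>A p-group has nontrivial fixed points on the nontrivial p-group H/K. They form a
  subgroup F/K, which is normal because H/K is cyclic, and so is everything because H/K is chief.
  The order of H/K and its automorphism group need not be determined.\<close>

lemma p_subgroup_centralizes_cyclic_chief_factor:
  assumes "finite (carrier G)" "Factorial_Ring.prime p" "chief_factor G H K" "cyclic_over G H K"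
    and "card H = p ^ a" "subgroup R G" "card R = p ^ n" "r \<in> R" "t \<in> H"
  shows "inv t \<otimes> conjg G r t \<in> K"
proof -
  note ch = chief_factorD[OF assms(3)]
  interpret K: normal K G by (rule ch(2))
  interpret hom: group_hom G "G Mod K" "\<lambda>x. K #> x"
    by (rule group_hom.intro[OF is_group K.factorgroup_is_group
        group_hom_axioms.intro[OF K.r_coset_hom_Mod]])
  have HG: "H \<subseteq> carrier G" by (rule normalD(2)[OF ch(1)])
  have RG: "r \<in> carrier G" if "r \<in> R" for r by (rule subgroup.mem_carrier[OF assms(6) that])
  define c where "c = (\<lambda>x. K #> x)"
  define Y where "Y = c ` H"
  interpret act: group_action "G\<lparr>carrier := R\<rparr>" Y "\<lambda>r. \<lambda>C\<in>Y. conjg G (inv r) ` C"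
  proof (rule conjg_action[OF assms(6)])
    show "C \<subseteq> carrier G" if "C \<in> Y" for C
      using that HG K.subset unfolding Y_def c_def by (auto dest!: r_coset_subset_G[THEN subsetD, rotated 2])
    show "conjg G r ` C \<in> Y" if r: "r \<in> R" and C: "C \<in> Y" for r C
    proof -
      obtain h where h: "h \<in> H" "C = c h" using C unfolding Y_def by blast
      have "conjg G r ` C = c (conjg G r h)"
        unfolding h(2) c_def by (rule conjg_rcoset[OF ch(2) RG[OF r]]) (use h HG in blast)
      moreover have "conjg G r h \<in> H" by (rule normalD(6)[OF ch(1) RG[OF r] h(1)])
      ultimately show ?thesis unfolding Y_def by blast
    qed
  qed
  have finH: "finite H" using assms(1) HG finite_subset by blast
  \<comment> \<open>The preimage in H of the fixed points of R on H/K, so that the subgroup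
    properties are checked in G.\<close>
  define F where "F = {t\<in>H. \<forall>r\<in>R. c (conjg G r t) = c t}"
  have "subgroup F G"
  proof (rule subgroupI)
    show "F \<subseteq> carrier G" using HG by (auto simp: F_def)
    have "conjg G r \<one> = \<one>" if "r \<in> R" for r using RG[OF that] by (simp add: conjg_def)
    then have "\<one> \<in> F" using normalD(3)[OF ch(1)] by (simp add: F_def)
    then show "F \<noteq> {}" by blast
  next
    fix x assume x: "x \<in> F"
    then have xG: "x \<in> carrier G" "x \<in> H" using HG by (auto simp: F_def)
    have "c (conjg G r (inv x)) = c (inv x)" if "r \<in> R" for r
      using x that RG[OF that] xG hom.hom_inv[of x] hom.hom_inv[of "conjg G r x"]
      by (simp add: F_def c_def conjg_inv)
    then show "inv x \<in> F" using xG normalD(5)[OF ch(1)] by (simp add: F_def)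
  next
    fix x y assume xy: "x \<in> F" "y \<in> F"
    then have G: "x \<in> carrier G" "x \<in> H" "y \<in> carrier G" "y \<in> H" using HG by (auto simp: F_def)
    have "c (conjg G r (x \<otimes> y)) = c (x \<otimes> y)" if "r \<in> R" for r
      using xy that RG[OF that] G hom.hom_mult[of x y] hom.hom_mult[of "conjg G r x" "conjg G r y"]
      by (simp add: F_def c_def conjg_hom)
    then show "x \<otimes> y \<in> F" using G normalD(4)[OF ch(1)] by (simp add: F_def)
  qed
  have self: "c x = K \<longleftrightarrow> x \<in> K" if "x \<in> carrier G" for x
    unfolding c_def by (rule rcoset_eq_self_iff[OF K.subgroup_axioms that])
  have KF: "K \<subseteq> F"
  proof
    fix x assume x: "x \<in> K"
    then have xG: "x \<in> carrier G" using K.subset by blast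
    have "c (conjg G r x) = K" if "r \<in> R" for r
      using self[of "conjg G r x"] RG[OF that] xG normalD(6)[OF ch(2) RG[OF that] x] by simp
    then show "x \<in> F" using x ch(3) self[OF xG] by (auto simp: F_def)
  qed
  have fix_eq: "{C\<in>Y. \<forall>r\<in>R. conjg G (inv r) ` C = C} = c ` F"
  proof -
    have "(\<forall>r\<in>R. conjg G (inv r) ` c h = c h) \<longleftrightarrow> (\<forall>r\<in>R. c (conjg G r h) = c h)" if h: "h \<in> H" for h
    proof -
      have hG: "h \<in> carrier G" using h HG by blast
      have "conjg G (inv r) ` c h = c (conjg G (inv r) h)" if "r \<in> R" for r
        unfolding c_def using RG[OF that] by (intro conjg_rcoset[OF ch(2) _ hG]) simp
      moreover have "inv r \<in> R" "inv (inv r) = r" if "r \<in> R" for r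
        using subgroup.m_inv_closed[OF assms(6) that] RG[OF that] by simp_all
      ultimately show ?thesis by metis
    qed
    then show ?thesis unfolding Y_def F_def by auto
  qed
  have ord: "Coset.order (G\<lparr>carrier := R\<rparr>) = p ^ n" using assms(7) by (simp add: Coset.order_def)
  have finY: "finite Y" using finH by (simp add: Y_def)
  have "{C\<in>Y. \<forall>r\<in>carrier (G\<lparr>carrier := R\<rparr>). (\<lambda>C\<in>Y. conjg G (inv r) ` C) C = C} = c ` F"
    unfolding fix_eq[symmetric] by auto
  then have p1: "p dvd card (Y - c ` F)"
    using act.dvd_card_nonfixed_points[OF assms(2) ord finY] by simp
  have lag: "card Y * card K = p ^ a"
  proof -
    have "Y = rcosets\<^bsub>G\<lparr>carrier := H\<rparr>\<^esub> K" unfolding Y_def c_def RCOSETS_def by auto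
    then show ?thesis
      using group.lagrange[OF subgroup_imp_group[OF normalD(1)[OF ch(1)]]
          subgroup_incl[OF normalD(1)[OF ch(2)] normalD(1)[OF ch(1)]]] ch(3) assms(5)
      by (simp add: Coset.order_def)
  qed
  have "card K < p ^ a" using psubset_card_mono[OF finH ch(3)] assms(5) by simp
  then have "card Y \<noteq> 1" using lag by auto
  moreover obtain j where j: "card Y = p ^ j"
    using lag divides_primepow_nat[OF assms(2)] by (metis dvd_triv_left)
  ultimately have pY: "p dvd card Y" by (cases j) auto
  have FY: "c ` F \<subseteq> Y" by (auto simp: Y_def F_def)
  have "card Y = card (Y - c ` F) + card (c ` F)"
    using card_Diff_subset[OF rev_finite_subset[OF finY FY] FY] card_mono[OF finY FY] by linarith
  then have pF: "p dvd card (c ` F)" using pY p1 by (metis dvd_add_right_iff)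
  have "F \<noteq> K"
  proof
    assume "F = K"
    have cK: "c x = K" if x: "x \<in> K" for x using self[OF subsetD[OF K.subset x]] x by simp
    have "c ` F = {K}"
      using cK imageI[OF K.one_closed, of c] cK[OF K.one_closed] unfolding \<open>F = K\<close> by (intro equalityI) auto
    then have "p dvd 1" using pF by simp
    then show False using assms(2) by (simp add: prime_gt_1_nat)
  qed
  have FH: "F \<subseteq> H" by (auto simp: F_def)
  have "F \<lhd> G" by (rule cyclic_over_normal[OF assms(4) ch(1,2) \<open>subgroup F G\<close> KF FH])
  then have "F = H" using ch(4)[OF _ KF FH] \<open>F \<noteq> K\<close> by blast
  then have "c (conjg G r t) = c t" using assms(8,9) by (auto simp: F_def)
  moreover have tG: "t \<in> carrier G" and rG: "r \<in> carrier G" using assms(8,9) HG RG by auto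
  moreover have "c (inv t \<otimes> conjg G r t) = c (inv t) <#> c (conjg G r t)"
    using tG rG hom.hom_mult[of "inv t" "conjg G r t"] by (simp add: c_def)
  moreover have "c (inv t \<otimes> t) = c (inv t) <#> c t"
    using tG hom.hom_mult[of "inv t" t] by (simp add: c_def del: l_inv)
  ultimately have "c (inv t \<otimes> conjg G r t) = c \<one>" by simp
  then show ?thesis using self[of "inv t \<otimes> conjg G r t"] self[of \<one>] tG rG K.one_closed by simp
qed

text \<open>The stability group of the series: \<open>inv t \<otimes> conjg G a t\<close> is the
  commutator [t,a], so a acts trivially on each factor T (Suc i)/T i with i < n.\<close>

definition series_centralizer :: "nat \<Rightarrow> (nat \<Rightarrow> 'a set) \<Rightarrow> 'a set" where
  "series_centralizer n T = {a \<in> carrier G. \<forall>i<n. \<forall>t\<in>T (Suc i). inv t \<otimes> conjg G a t \<in> T i}"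

lemma series_centralizer_normal:
  assumes "\<And>i. i \<le> n \<Longrightarrow> T i \<lhd> G"
  shows "series_centralizer n T \<lhd> G"
proof -
  have TG: "t \<in> carrier G" if "t \<in> T i" "i \<le> n" for t i using that normalD(2)[OF assms] by blast
  let ?A = "series_centralizer n T"
  have "subgroup ?A G"
  proof (rule subgroupI)
    show "?A \<subseteq> carrier G" by (auto simp: series_centralizer_def)
    have "\<one> \<in> ?A" using normalD(3)[OF assms] TG by (auto simp: series_centralizer_def)
    then show "?A \<noteq> {}" by blast
  next
    fix a assume a: "a \<in> ?A"
    then have aG: "a \<in> carrier G" by (simp add: series_centralizer_def)
    have "inv t \<otimes> conjg G (inv a) t \<in> T i" if "i < n" "t \<in> T (Suc i)" for i t
    proof -
      have t: "t \<in> carrier G" using that TG by auto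
      have s: "conjg G (inv a) t \<in> T (Suc i)" using that aG by (intro normalD(6)[OF assms]) auto
      \<comment> \<open>The condition on a, evaluated at the conjugate of t by \<open>inv a\<close>,
        is the inverse of the condition required of \<open>inv a\<close> at t.\<close>
      then have "inv (conjg G (inv a) t) \<otimes> conjg G a (conjg G (inv a) t) \<in> T i"
        using a that(1) by (auto simp: series_centralizer_def)
      then have "inv (inv (conjg G (inv a) t) \<otimes> t) \<in> T i"
        using aG t normalD(5)[OF assms[of i]] that(1) by simp
      then show ?thesis using aG t by (simp add: inv_mult_group)
    qed
    then show "inv a \<in> ?A" using aG by (simp add: series_centralizer_def)
  next
    fix a b assume ab: "a \<in> ?A" "b \<in> ?A"
    then have G: "a \<in> carrier G" "b \<in> carrier G" by (auto simp: series_centralizer_def)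
    have "inv t \<otimes> conjg G (a \<otimes> b) t \<in> T i" if "i < n" "t \<in> T (Suc i)" for i t
    proof -
      have t: "t \<in> carrier G" using that TG by auto
      have s: "conjg G a t \<in> T (Suc i)" using that G by (intro normalD(6)[OF assms]) auto
      \<comment> \<open>The commutator identity [t,ab] = [t,a][t^a,b]; the second factor is the
        condition on b at t^a.\<close>
      have "inv t \<otimes> conjg G a t \<in> T i" "inv (conjg G a t) \<otimes> conjg G b (conjg G a t) \<in> T i"
        using ab that s by (auto simp: series_centralizer_def)
      then have "(inv t \<otimes> conjg G a t) \<otimes> (inv (conjg G a t) \<otimes> conjg G b (conjg G a t)) \<in> T i"
        by (rule normalD(4)[OF assms[OF less_imp_le[OF that(1)]]])
      then show ?thesis using t G by (simp add: m_assoc conjg_mult)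
    qed
    then show "a \<otimes> b \<in> ?A" using G by (simp add: series_centralizer_def)
  qed
  moreover have "conjg G g a \<in> ?A" if g: "g \<in> carrier G" and a: "a \<in> ?A" for g a
  proof -
    have aG: "a \<in> carrier G" using a by (simp add: series_centralizer_def)
    have "inv t \<otimes> conjg G (conjg G g a) t \<in> T i" if "i < n" "t \<in> T (Suc i)" for i t
    proof -
      have t: "t \<in> carrier G" using that TG by auto
      have s: "conjg G (inv g) t \<in> T (Suc i)" using that g by (intro normalD(6)[OF assms]) auto
      then have "inv (conjg G (inv g) t) \<otimes> conjg G a (conjg G (inv g) t) \<in> T i"
        using a that(1) by (auto simp: series_centralizer_def)
      then have "conjg G g (inv (conjg G (inv g) t) \<otimes> conjg G a (conjg G (inv g) t)) \<in> T i"
        using that(1) g by (intro normalD(6)[OF assms]) auto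
      moreover have "conjg G g (inv (conjg G (inv g) t) \<otimes> conjg G a (conjg G (inv g) t))
          = inv t \<otimes> conjg G (conjg G g a) t"
        using g aG t by (simp add: conjg_def inv_mult_group m_assoc)
      ultimately show ?thesis by simp
    qed
    then show ?thesis using g aG by (simp add: series_centralizer_def)
  qed
  ultimately show ?thesis unfolding normal_iff_conjg by blast
qed

text \<open>This says elementwise that the stability group induces a p-group on the series. If b
  centralizes T i and t lies in T (Suc i), then b sends t to tz with z in T i fixed by b, so b^k
  sends t to tz^k; as z lies in a group of order p^e, the power b^(p^e) fixes t.\<close>

lemma series_centralizer_power:
  assumes "finite (carrier G)" "\<And>i. i \<le> n \<Longrightarrow> T i \<lhd> G" "T 0 = {\<one>}"
    and "\<And>i. i \<le> n \<Longrightarrow> T i \<subseteq> N" "subgroup N G" "card N = p ^ e" "a \<in> series_centralizer n T" "i \<le> n"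
  shows "\<exists>m. a [^] (p ^ m :: nat) \<in> centralizer G (T i)"
  using assms(8)
proof (induction i)
  case 0
  have "a \<in> carrier G" using assms(7) by (simp add: series_centralizer_def)
  then show ?case using assms(3) by (auto simp: centralizer_def conjg_def)
next
  case (Suc i)
  then obtain m where m: "a [^] (p ^ m :: nat) \<in> centralizer G (T i)" by auto
  define b where "b = a [^] (p ^ m :: nat)"
  have A: "subgroup (series_centralizer n T) G"
    using normalD(1)[OF series_centralizer_normal[of n T]] assms(2) by blast
  have aG: "a \<in> carrier G" using assms(7) by (simp add: series_centralizer_def)
  have bA: "b \<in> series_centralizer n T"
    unfolding b_def using subgroup_int_pow_closed[OF A assms(7), of "int (p ^ m)"]
    by (simp only: int_pow_int)
  have bG: "b \<in> carrier G" using aG by (simp add: b_def)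
  have "conjg G (b [^] (p ^ e :: nat)) t = t" if t: "t \<in> T (Suc i)" for t
  proof -
    have tG: "t \<in> carrier G" using t normalD(2)[OF assms(2)[OF Suc.prems]] by blast
    define z where "z = inv t \<otimes> conjg G b t"
    have z: "z \<in> T i" using bA t Suc.prems by (auto simp: series_centralizer_def z_def)
    then have bz: "conjg G b z = z" using m by (simp add: b_def centralizer_def)
    have zN: "z \<in> N" using z assms(4)[of i] Suc.prems by auto
    then have zG: "z \<in> carrier G" by (rule subgroup.mem_carrier[OF assms(5)])
    have bt: "conjg G b t = t \<otimes> z" using bG tG by (simp add: z_def)
    have "conjg G (b [^] k) t = t \<otimes> z [^] k \<and> conjg G (b [^] k) z = z" for k :: nat
    proof (induction k)
      case (Suc k)
      have "conjg G b (z [^] k) = z [^] k"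
        using conjg_int_pow[OF bG zG, of "int k"] bz by (simp add: int_pow_int)
      then have "conjg G b (t \<otimes> z [^] k) = t \<otimes> (z \<otimes> z [^] k)"
        using bG tG zG bt by (simp add: conjg_hom m_assoc)
      moreover have "z \<otimes> z [^] k = z [^] Suc k" using zG nat_pow_Suc2 by simp
      ultimately show ?case using Suc bG tG zG bz by (simp add: conjg_mult)
    qed (use tG zG in simp)
    moreover have "z [^] (p ^ e) = \<one>"
    proof -
      interpret N: group "G\<lparr>carrier := N\<rparr>" using assms(5) by (rule subgroup_imp_group)
      have "z [^]\<^bsub>G\<lparr>carrier := N\<rparr>\<^esub> Coset.order (G\<lparr>carrier := N\<rparr>) = \<one>\<^bsub>G\<lparr>carrier := N\<rparr>\<^esub>"
        using zN by (intro N.pow_order_eq_1) simp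
      then show ?thesis using assms(6) by (simp add: Coset.order_def nat_pow_consistent[symmetric])
    qed
    ultimately show ?thesis using tG by simp
  qed
  then have "b [^] (p ^ e) \<in> centralizer G (T (Suc i))" using bG by (simp add: centralizer_def)
  then show ?case using aG by (auto simp: b_def nat_pow_pow simp flip: power_add)
qed

section \<open>Subgroups containing a Sylow subgroup for every prime\<close>

lemma sylow_index_intermediate:
  assumes "finite (carrier G)" "Factorial_Ring.prime q" "sylow_subgroup q G U"
    and "subgroup B G" "U \<subseteq> B"
  shows "\<not> q dvd card (rcosets B)"
proof -
  have U: "subgroup U G" using assms(3) by (rule sylow_subgroup_imp_subgroup)
  have UB: "subgroup U (G\<lparr>carrier := B\<rparr>)" by (rule subgroup_incl[OF U assms(4,5)])
  define b where "b = card (rcosets\<^bsub>G\<lparr>carrier := B\<rparr>\<^esub> U)"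
  have "b * card U = card B"
    unfolding b_def using group.lagrange[OF subgroup_imp_group[OF assms(4)] UB] by (simp add: Coset.order_def)
  moreover have "card (rcosets U) * card U = Coset.order G" "card (rcosets B) * card B = Coset.order G"
    using lagrange U assms(4) by auto
  ultimately have "card (rcosets U) * card U = card (rcosets B) * b * card U" by (metis mult.assoc)
  moreover have "card U \<noteq> 0"
    using finite_subgroup[OF assms(1) U] subgroup.one_closed[OF U] by auto
  ultimately have "card (rcosets U) = card (rcosets B) * b" by simp
  then show ?thesis using sylow_index_not_dvd[OF assms(1-3)] by auto
qed

text \<open>No prime divides the index of such a subgroup. This replaces comparing orders in a
  quotient when A = CR is to be shown from A being a p-group modulo C.\<close>

lemma eq_carrier_if_sylows_subset:
  assumes "finite (carrier G)" "subgroup B G"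
    and "\<And>q. Factorial_Ring.prime q \<Longrightarrow> \<exists>U. sylow_subgroup q G U \<and> U \<subseteq> B"
  shows "B = carrier G"
proof -
  have "card (rcosets B) = 1"
  proof (rule ccontr)
    assume "card (rcosets B) \<noteq> 1"
    then obtain q where "Factorial_Ring.prime q" "q dvd card (rcosets B)" using prime_factor_nat by blast
    then show False using assms(3) sylow_index_intermediate[OF assms(1) _ _ assms(2)] by blast
  qed
  then have "card B = card (carrier G)" using lagrange[OF assms(2)] by (simp add: Coset.order_def)
  then show ?thesis using assms(1) subgroup.subset[OF assms(2)] by (simp add: card_subset_eq)
qed


section \<open>Hypercyclic normal p-subgroups\<close>

lemma chief_series_terms:
  assumes "\<And>i. i < n \<Longrightarrow> chief_factor G (T (Suc i)) (T i)" "T n \<lhd> G" "i \<le> n"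
  shows "T i \<lhd> G" "T i \<subseteq> T n"
proof -
  show "T i \<lhd> G" using assms chief_factorD(2)[OF assms(1)] by (cases "i = n") auto
  show "T i \<subseteq> T n" using assms(3)
    by (induction rule: inc_induct) (use chief_factorD(3)[OF assms(1)] in auto)
qed

lemma centralizer_normal:
  assumes "N \<lhd> G" shows "centralizer G N \<lhd> G"
  unfolding normal_iff_conjg
proof (intro conjI ballI)
  show "subgroup (centralizer G N) G" by (rule centralizer_subgroup[OF normalD(2)[OF assms]])
  fix g x assume "g \<in> carrier G" "x \<in> centralizer G N"
  then show "conjg G g x \<in> centralizer G N"
    using centralizer_conjg[OF normalD(2)[OF assms]] normal_conjg_image[OF assms] by force
qed

text \<open>Bezout in natural numbers, mx = ky + 1, writes u as the inverse of u^(ky) times u^(mx).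
  It will be applied to an element of q-power order that has a p-power in C.\<close>

lemma pow_mem_cancel:
  assumes "subgroup C G" "u \<in> carrier G" "u [^] (m::nat) \<in> C" "u [^] (k::nat) \<in> C" "coprime m k" "m \<noteq> 0"
  shows "u \<in> C"
proof -
  obtain x y where xy: "m * x = k * y + 1" using bezout_nat[OF assms(6), of k] assms(5) by auto
  have pw: "(u [^] j) [^] (l::nat) \<in> C" if "u [^] j \<in> C" for j l :: nat
    using subgroup_int_pow_closed[OF assms(1) that, of "int l"] by (simp only: int_pow_int)
  have "u [^] (m * x) \<in> C" "u [^] (k * y) \<in> C"
    using pw[OF assms(3), of x] pw[OF assms(4), of y] assms(2) by (simp_all add: nat_pow_pow)
  then have "inv (u [^] (k * y)) \<otimes> u [^] (k * y + 1) \<in> C"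
    using assms(1) xy by (simp add: subgroup.m_closed subgroup.m_inv_closed)
  moreover have "u [^] (k * y + 1) = u [^] (k * y) \<otimes> u" using assms(2) by simp
  ultimately show ?thesis using assms(2) by simp
qed

text \<open>The subgroup A acting trivially on a chief series of N
  contains every Sylow p-subgroup R (a p-element acts trivially on cyclic chief p-factors) and is a
  p-group modulo the centralizer C of N, so A = CR; the Frattini argument applies to A.\<close>
lemma hypercyclic_frattini:
  assumes fin: "finite (carrier G)" and p: "Factorial_Ring.prime p" and hyp: "hypercyclic G N"
    and cN: "card N = p ^ e" and R: "sylow_subgroup p G R" and x: "x \<in> carrier G"
  obtains c y where "c \<in> centralizer G N" "y \<in> normalizer G R" "x = c \<otimes> y"
proof -
  have N: "N \<lhd> G" using hyp by (simp add: hypercyclic_def)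
  obtain n T where T: "T (0::nat) = {\<one>}" "T n = N"
    and ch: "\<And>i. i < n \<Longrightarrow> chief_factor G (T (Suc i)) (T i)"
    using chief_series[OF fin N] by auto
  have Tn: "T i \<lhd> G" "T i \<subseteq> N" if "i \<le> n" for i
    using chief_series_terms[of n T i, OF ch] that N T(2) by simp_all
  define A where "A = series_centralizer n T"
  define C where "C = centralizer G N"
  have An: "A \<lhd> G" unfolding A_def by (rule series_centralizer_normal[OF Tn(1)])
  have A: "subgroup A G" by (rule normalD(1)[OF An])
  have Cn: "C \<lhd> G" unfolding C_def by (rule centralizer_normal[OF N])
  have C: "subgroup C G" by (rule normalD(1)[OF Cn])
  have Rg: "subgroup R G" by (rule sylow_subgroup_imp_subgroup[OF R])
  obtain r where r: "card R = p ^ r" using R by (auto simp: sylow_subgroup_def)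
  have RA: "R \<subseteq> A"
  proof
    fix a assume a: "a \<in> R"
    have "inv t \<otimes> conjg G a t \<in> T i" if i: "i < n" and t: "t \<in> T (Suc i)" for i t
    proof -
      have s: "T (Suc i) \<subseteq> N" using Tn(2)[of "Suc i"] i by simp
      obtain k where "card (T (Suc i)) = p ^ k"
        using p_subgroup_card[OF fin p normalD(1)[OF N] cN normalD(1)[OF chief_factorD(1)[OF ch[OF i]]] s]
        by blast
      moreover have "cyclic_over G (T (Suc i)) (T i)"
        using hyp ch[OF i] s unfolding hypercyclic_def by blast
      ultimately show ?thesis
        using p_subgroup_centralizes_cyclic_chief_factor[OF fin p ch[OF i] _ _ Rg r a t] by blast
    qed
    then show "a \<in> A"
      using subgroup.mem_carrier[OF Rg a] unfolding A_def series_centralizer_def by blast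
  qed
  have CA: "C \<subseteq> A"
  proof
    fix a assume a: "a \<in> C"
    have aG: "a \<in> carrier G" by (rule subgroup.mem_carrier[OF C a])
    have "inv t \<otimes> conjg G a t \<in> T i" if i: "i < n" and t: "t \<in> T (Suc i)" for i t
    proof -
      have tN: "t \<in> N" using Tn(2)[of "Suc i"] i t by auto
      then have "conjg G a t = t" using a by (simp add: C_def centralizer_def)
      then show ?thesis using normalD(3)[OF Tn(1)[of i]] i tN normalD(2)[OF N] by (simp add: subsetD)
    qed
    then show "a \<in> A" using aG unfolding A_def series_centralizer_def by blast
  qed
  interpret A: group "G\<lparr>carrier := A\<rparr>" using A by (rule subgroup_imp_group)
  have finA: "finite A" by (rule finite_subgroup[OF fin A])
  \<comment> \<open>The whole group is written as a carrier update, so that the results about a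
    subgroup K apply with K = G.\<close>
  have nA: "A \<lhd> G\<lparr>carrier := carrier G\<rparr>" using An by simp
  have RG: "sylow_subgroup p (G\<lparr>carrier := carrier G\<rparr>) R" using R by simp
  have RsA: "sylow_subgroup p (G\<lparr>carrier := A\<rparr>) R"
    using sylow_Int_normal[OF fin p subgroup_self RG nA] RA by (simp add: Int_absorb2)
  define B where "B = C <#> R"
  have Bg: "subgroup B G"
    unfolding B_def
    using second_isomorphism_grp.normal_set_mult_subgroup[of C G R] Cn Rg
    by (simp add: second_isomorphism_grp_def second_isomorphism_grp_axioms_def)
  have CB: "C \<subseteq> B" and RB: "R \<subseteq> B"
  proof -
    have "c \<otimes> \<one> \<in> B" if "c \<in> C" for c
      unfolding B_def set_mult_def using that subgroup.one_closed[OF Rg] by blast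
    then show "C \<subseteq> B" using subgroup.mem_carrier[OF C] by (metis r_one subsetI)
    have "\<one> \<otimes> c \<in> B" if "c \<in> R" for c
      unfolding B_def set_mult_def using that subgroup.one_closed[OF C] by blast
    then show "R \<subseteq> B" using subgroup.mem_carrier[OF Rg] by (metis l_one subsetI)
  qed
  have BA: "B \<subseteq> A" unfolding B_def by (rule set_mult_subset_subgroup[OF A CA RA])
  \<comment> \<open>For the prime p the Sylow subgroup R lies in B. For another prime q, elements of
    q-power order in A have a p-power in C and hence lie in C.\<close>
  have "B = carrier (G\<lparr>carrier := A\<rparr>)"
  proof (rule A.eq_carrier_if_sylows_subset)
    show "finite (carrier (G\<lparr>carrier := A\<rparr>))" using finA by simp
    show "subgroup B (G\<lparr>carrier := A\<rparr>)" by (rule subgroup_incl[OF Bg A BA])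
    fix q :: nat assume q: "Factorial_Ring.prime q"
    show "\<exists>U. sylow_subgroup q (G\<lparr>carrier := A\<rparr>) U \<and> U \<subseteq> B"
    proof (cases "q = p")
      case True
      then show ?thesis using RsA RB by blast
    next
      case False
      obtain U where U: "sylow_subgroup q (G\<lparr>carrier := A\<rparr>) U" using A.sylow_exists[OF _ q] finA by auto
      then obtain k where k: "card U = q ^ k" by (auto simp: sylow_subgroup_def)
      have Ug: "subgroup U G" "U \<subseteq> A"
        using U subgroup_consistent_iff[OF A] by (auto simp: sylow_subgroup_def)
      have "u \<in> C" if u: "u \<in> U" for u
      proof -
        have uG: "u \<in> carrier G" by (rule subgroup.mem_carrier[OF Ug(1) u])
        have uA: "u \<in> series_centralizer n T" using u Ug(2) by (auto simp: A_def)
        obtain m where m: "u [^] (p ^ m :: nat) \<in> C"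
          using series_centralizer_power[OF fin Tn(1) T(1) Tn(2) normalD(1)[OF N] cN uA order_refl]
          unfolding T(2) C_def by blast
        interpret U: group "G\<lparr>carrier := U\<rparr>" using Ug(1) by (rule subgroup_imp_group)
        have "u [^]\<^bsub>G\<lparr>carrier := U\<rparr>\<^esub> Coset.order (G\<lparr>carrier := U\<rparr>) = \<one>\<^bsub>G\<lparr>carrier := U\<rparr>\<^esub>"
          using u by (intro U.pow_order_eq_1) simp
        then have "u [^] (q ^ k) = \<one>" using k by (simp add: Coset.order_def nat_pow_consistent[symmetric])
        then have "u [^] (q ^ k) \<in> C" using subgroup.one_closed[OF C] by simp
        moreover have "coprime (p ^ m) (q ^ k)"
          using primes_coprime[OF p q] False by (intro coprime_power_left_iff[THEN iffD2] disjI1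
            coprime_power_right_iff[THEN iffD2]) auto
        moreover have "p ^ m \<noteq> 0" using p by (simp add: prime_gt_0_nat)
        ultimately show ?thesis by (rule pow_mem_cancel[OF C uG m])
      qed
      then show ?thesis using U CB by blast
    qed
  qed
  then have AB: "A = B" by simp
  \<comment> \<open>The component of a in R normalizes R and is absorbed into the second factor,
    leaving a component in C.\<close>
  obtain a y where ay: "a \<in> A" "y \<in> normalizer G R" "x = a \<otimes> y"
    using frattini[OF fin p subgroup_self nA RsA x] .
  obtain c s where cs: "c \<in> C" "s \<in> R" "a = c \<otimes> s"
    using ay(1) unfolding AB B_def by (rule set_mult_memE)
  have nr: "subgroup (normalizer G R) G" by (rule normalizer_imp_subgroup[OF subgroup.subset[OF Rg]])
  have "s \<in> normalizer G R" using cs(2) subgroup_subset_normalizer[OF Rg] by blast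
  then have "s \<otimes> y \<in> normalizer G R" using ay(2) by (rule subgroup.m_closed[OF nr])
  moreover have "x = c \<otimes> (s \<otimes> y)"
    using ay(3) cs subgroup.mem_carrier[OF C cs(1)] subgroup.mem_carrier[OF Rg cs(2)]
      subgroup.mem_carrier[OF nr ay(2)] by (simp add: m_assoc)
  ultimately show ?thesis using that cs(1) unfolding C_def by blast
qed

section \<open>Control of fusion\<close>

text \<open>Since conjugation acts from the right, c acts first and fixes P pointwise, so g and n
  induce the same map on P. The factorization restricts to subgroups of P, whose centralizers are
  larger.\<close>

definition fusion_controlled :: "'a set \<Rightarrow> 'a set \<Rightarrow> bool" where
  "fusion_controlled S P \<longleftrightarrow> (\<forall>g\<in>carrier G. conjg G g ` P \<subseteq> S \<longrightarrow>
     (\<exists>c\<in>centralizer G P. \<exists>n\<in>normalizer G S. g = c \<otimes> n))"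

lemma fusion_controlledD:
  assumes "fusion_controlled S U" "P \<subseteq> U" "g \<in> carrier G" "conjg G g ` U \<subseteq> S"
  obtains c n where "c \<in> centralizer G P" "n \<in> normalizer G S" "g = c \<otimes> n"
  using assms centralizer_antimono[OF assms(2)] unfolding fusion_controlled_def by blast

lemma normalizer_conjg:
  assumes "P \<subseteq> carrier G" "g \<in> carrier G"
  shows "normalizer G (conjg G g ` P) = conjg G g ` normalizer G P"
proof -
  have sub: "conjg G h ` normalizer G P \<subseteq> normalizer G (conjg G h ` P)"
    if P: "P \<subseteq> carrier G" and h: "h \<in> carrier G" for P h
  proof
    fix y assume "y \<in> conjg G h ` normalizer G P"
    then obtain x where x: "x \<in> carrier G" "conjg G x ` P = P" "y = conjg G h x"
      using mem_normalizer[OF P] by blast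
    have "conjg G y ` conjg G h ` P = conjg G (h \<otimes> y) ` P"
      using x h P by (simp add: conjg_image_mult)
    also have "h \<otimes> y = x \<otimes> h" using x h by (simp add: conjg_def m_assoc)
    also have "conjg G (x \<otimes> h) ` P = conjg G h ` P" using x h P by (simp add: conjg_image_mult)
    finally show "y \<in> normalizer G (conjg G h ` P)"
      using x h mem_normalizer[OF conjg_image_subset[OF h P]] by simp
  qed
  have gP: "conjg G g ` P \<subseteq> carrier G" by (rule conjg_image_subset[OF assms(2,1)])
  have nG: "normalizer G (conjg G g ` P) \<subseteq> carrier G" using mem_normalizer[OF gP] by blast
  have "conjg G (inv g) ` normalizer G (conjg G g ` P) \<subseteq> normalizer G P"
    using sub[OF gP inv_closed[OF assms(2)]] assms by (simp flip: conjg_image_mult)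
  then have "conjg G g ` conjg G (inv g) ` normalizer G (conjg G g ` P) \<subseteq> conjg G g ` normalizer G P"
    by (rule image_mono)
  moreover have "conjg G g ` conjg G (inv g) ` normalizer G (conjg G g ` P) = normalizer G (conjg G g ` P)"
    using nG assms(2) by (simp flip: conjg_image_mult)
  ultimately show ?thesis using sub[OF assms] by (simp add: subset_antisym)
qed

text \<open>Alperin's argument: it suffices to treat the automizers of the fully normalized subgroups.\<close>
lemma normalizer_controls_fusion:
  assumes fin: "finite (carrier G)" and p: "Factorial_Ring.prime p" and S: "sylow_subgroup p G S"
    and step: "\<And>Q x. \<lbrakk>subgroup Q G; Q \<subset> S;
        sylow_subgroup p (G\<lparr>carrier := normalizer G Q\<rparr>) (normalizer G Q \<inter> S);
        \<And>U. \<lbrakk>subgroup U G; U \<subseteq> S; card Q < card U\<rbrakk> \<Longrightarrow> fusion_controlled S U;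
        x \<in> normalizer G Q\<rbrakk> \<Longrightarrow> \<exists>c\<in>centralizer G Q. \<exists>n\<in>normalizer G S. x = c \<otimes> n"
    and P: "subgroup P G" "P \<subseteq> S"
  shows "fusion_controlled S P"
  using P
proof (induction "card S - card P" arbitrary: P rule: less_induct)
  case (less P)
  note P = less.prems
  have Sg: "subgroup S G" by (rule sylow_subgroup_imp_subgroup[OF S])
  have SG: "S \<subseteq> carrier G" by (rule subgroup.subset[OF Sg])
  have finS: "finite S" by (rule finite_subgroup[OF fin Sg])
  have PG: "P \<subseteq> carrier G" by (rule subgroup.subset[OF P(1)])
  have finP: "finite P" by (rule finite_subgroup[OF fin P(1)])
  obtain s where s: "card S = p ^ s" using S by (auto simp: sylow_subgroup_def)
  obtain r where r: "card P = p ^ r" using p_subgroup_card[OF fin p Sg s P] by blast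
  show ?case
  proof (cases "P = S")
    case True
    have "\<exists>c\<in>centralizer G S. \<exists>n\<in>normalizer G S. g = c \<otimes> n"
      if "g \<in> carrier G" "conjg G g ` S \<subseteq> S" for g
    proof -
      have "g \<in> normalizer G S"
        using mem_normalizer[OF SG] conjg_subset_imp_eq[OF finS that(1) SG that(2)] that(1) by blast
      moreover have "g = \<one> \<otimes> g" using that(1) by simp
      ultimately show ?thesis using subgroup.one_closed[OF centralizer_subgroup[OF SG]] by blast
    qed
    then show ?thesis unfolding fusion_controlled_def True by blast
  next
    case False
    have cPS: "card P < card S" using P(2) False finS by (simp add: psubset_card_mono psubsetI)
    have ih: "fusion_controlled S U" if "subgroup U G" "U \<subseteq> S" "card P < card U" for U
      using card_mono[OF finS that(2)] that by (intro less.hyps) auto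
    define K where "K = normalizer G P"
    have K: "subgroup K G" unfolding K_def by (rule normalizer_imp_subgroup[OF PG])
    have PK: "P \<subseteq> K" unfolding K_def by (rule subgroup_subset_normalizer[OF P(1)])
    obtain R0 where R0: "sylow_subgroup p (G\<lparr>carrier := K\<rparr>) R0"
      using group.sylow_exists[OF subgroup_imp_group[OF K] _ p] finite_subgroup[OF fin K] by auto
    then obtain r0 where r0: "card R0 = p ^ r0" by (auto simp: sylow_subgroup_def)
    have R0g: "subgroup R0 G" "R0 \<subseteq> K"
      using R0 subgroup_consistent_iff[OF K] by (auto simp: sylow_subgroup_def)
    have R0G: "R0 \<subseteq> carrier G" by (rule subgroup.subset[OF R0g(1)])
    obtain k where k: "k \<in> K" "conjg G k ` P \<subseteq> R0" using sylow_conj_in[OF fin p K R0 P(1) PK r] .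
    then have PR0: "P \<subseteq> R0" using mem_normalizer[OF PG] unfolding K_def by simp
    \<comment> \<open>A Sylow subgroup R0 of the normalizer of P is moved into S. The conjugate Q of
      P is then fully normalized: the image of R0 is Sylow in L and lies in L \<inter> S, so it
      equals L \<inter> S.\<close>
    obtain h where h: "h \<in> carrier G" "conjg G h ` R0 \<subseteq> S" using sylow_conj[OF fin p S R0g(1) r0] .
    define Q where "Q = conjg G h ` P"
    define L where "L = normalizer G Q"
    define R where "R = conjg G h ` R0"
    have Qg: "subgroup Q G" unfolding Q_def by (rule conjg_subgroup[OF h(1) P(1)])
    have QG: "Q \<subseteq> carrier G" by (rule subgroup.subset[OF Qg])
    have cQ: "card Q = card P" unfolding Q_def by (rule card_conjg[OF h(1) PG])
    have QS: "Q \<subset> S" using image_mono[OF PR0, of "conjg G h"] h(2) cQ cPS unfolding Q_def by auto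
    have L: "subgroup L G" unfolding L_def by (rule normalizer_imp_subgroup[OF QG])
    have LK: "L = conjg G h ` K" unfolding L_def Q_def K_def by (rule normalizer_conjg[OF PG h(1)])
    have Rg: "subgroup R G" unfolding R_def by (rule conjg_subgroup[OF h(1) R0g(1)])
    have RL: "R \<subseteq> L" unfolding R_def LK by (rule image_mono[OF R0g(2)])
    have cL: "card L = card K" unfolding LK by (rule card_conjg[OF h(1) subgroup.subset[OF K]])
    have cR: "card R = card R0" unfolding R_def by (rule card_conjg[OF h(1) R0G])
    have RsL: "sylow_subgroup p (G\<lparr>carrier := L\<rparr>) R"
      using R0 cL cR subgroup_incl[OF Rg L RL] by (simp add: sylow_subgroup_def Coset.order_def)
    have LS: "subgroup (L \<inter> S) G" by (rule subgroups_Inter_pair[OF L Sg])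
    obtain w where w: "card (L \<inter> S) = p ^ w" using p_subgroup_card[OF fin p Sg s LS] by blast
    obtain l where l: "l \<in> L" "conjg G l ` (L \<inter> S) \<subseteq> R"
      using sylow_conj_in[OF fin p L RsL LS Int_lower1 w] .
    have "card (L \<inter> S) \<le> card R"
      using card_mono[OF finite_subgroup[OF fin Rg] l(2)]
        card_conjg[OF subgroup.mem_carrier[OF L l(1)] subgroup.subset[OF LS]] by simp
    then have RLS: "R = L \<inter> S"
      using RL h(2) finite_subgroup[OF fin LS] by (intro card_seteq) (auto simp: R_def)
    have Qstep: "\<exists>c\<in>centralizer G Q. \<exists>n\<in>normalizer G S. x = c \<otimes> n" if "x \<in> L" for x
      by (rule step[OF Qg QS]) (use RsL RLS ih cQ that in \<open>simp_all add: L_def\<close>)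
    have NS: "subgroup (normalizer G S) G" by (rule normalizer_imp_subgroup[OF SG])
    \<comment> \<open>Any conjugate P' of Q in S is carried to Q by the normalizer of S. The map f
      takes N' into L, and an element k of L takes the image into R, hence into S; as N' is larger
      than P', the induction hypothesis factors f \<otimes> k, and k does not move Q.\<close>
    have to_Q: "\<exists>n\<in>normalizer G S. conjg G n ` P' = Q"
      if P': "subgroup P' G" "P' \<subseteq> S" "card P' = card P" and f: "f \<in> carrier G" "conjg G f ` P' = Q" for P' f
    proof -
      have P'G: "P' \<subseteq> carrier G" by (rule subgroup.subset[OF P'(1)])
      define N' where "N' = normalizer G P' \<inter> S"
      have N': "subgroup N' G" unfolding N'_def
        by (rule subgroups_Inter_pair[OF normalizer_imp_subgroup[OF P'G] Sg])
      have N'G: "N' \<subseteq> carrier G" by (rule subgroup.subset[OF N'])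
      have P'N: "P' \<subseteq> N'" using subgroup_subset_normalizer[OF P'(1)] P'(2) by (simp add: N'_def)
      have "P' \<subset> S" using P' cPS by auto
      then obtain g where g: "g \<in> S" "g \<notin> P'" "conjg G g ` P' = P'"
        using normalizer_growth[OF fin p Sg s P'(1)] by blast
      have "g \<in> N'" using g mem_normalizer[OF P'G] SG by (auto simp: N'_def)
      then have "card P' < card N'"
        using g(2) P'N finite_subgroup[OF fin N'] by (intro psubset_card_mono) auto
      then have ctrl: "fusion_controlled S N'" using P'(3) N' by (intro ih) (auto simp: N'_def)
      obtain w' where w': "card N' = p ^ w'"
        using p_subgroup_card[OF fin p Sg s N'] by (auto simp: N'_def)
      have "conjg G f ` N' \<subseteq> L"
        unfolding L_def f(2)[symmetric] normalizer_conjg[OF P'G f(1)] by (auto simp: N'_def)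
      moreover have "card (conjg G f ` N') = p ^ w'" using card_conjg[OF f(1) N'G] w' by simp
      ultimately obtain k where k: "k \<in> L" "conjg G k ` conjg G f ` N' \<subseteq> R"
        using sylow_conj_in[OF fin p L RsL conjg_subgroup[OF f(1) N']] by metis
      have kG: "k \<in> carrier G" by (rule subgroup.mem_carrier[OF L k(1)])
      have "conjg G (f \<otimes> k) ` N' \<subseteq> S"
        using k(2) RLS by (simp add: conjg_image_mult[OF f(1) kG N'G])
      then obtain c n where cn: "c \<in> centralizer G P'" "n \<in> normalizer G S" "f \<otimes> k = c \<otimes> n"
        using fusion_controlledD[OF ctrl P'N m_closed[OF f(1) kG]] by blast
      have G: "c \<in> carrier G" "n \<in> carrier G"
        using cn(1) subgroup.mem_carrier[OF NS cn(2)] by (auto simp: centralizer_def)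
      have "conjg G c ` P' = P'"
        using cn(1) centralizer_subset_normalizer[OF P'G] mem_normalizer[OF P'G] by blast
      then have "conjg G n ` P' = conjg G (c \<otimes> n) ` P'" by (simp add: conjg_image_mult[OF G P'G])
      also have "\<dots> = conjg G k ` Q"
        unfolding cn(3)[symmetric] conjg_image_mult[OF f(1) kG P'G] f(2) ..
      also have "\<dots> = Q" using k(1) mem_normalizer[OF QG] by (simp add: L_def)
      finally show ?thesis using cn(2) by blast
    qed
    obtain n1 where n1: "n1 \<in> normalizer G S" "conjg G n1 ` P = Q"
      using to_Q[OF P refl h(1)] by (auto simp: Q_def)
    have n1G: "n1 \<in> carrier G" by (rule subgroup.mem_carrier[OF NS n1(1)])
    have "\<exists>c\<in>centralizer G P. \<exists>n\<in>normalizer G S. g = c \<otimes> n"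
      if g: "g \<in> carrier G" "conjg G g ` P \<subseteq> S" for g
    proof -
      define P' where "P' = conjg G g ` P"
      have P': "subgroup P' G" unfolding P'_def by (rule conjg_subgroup[OF g(1) P(1)])
      have "conjg G (inv g \<otimes> h) ` P' = conjg G (g \<otimes> (inv g \<otimes> h)) ` P"
        unfolding P'_def using g(1) h(1) PG by (intro conjg_image_mult[symmetric]) auto
      also have "\<dots> = Q" using g(1) h(1) by (simp add: Q_def)
      finally obtain n2 where n2: "n2 \<in> normalizer G S" "conjg G n2 ` P' = Q"
        using to_Q[OF P' g(2)[folded P'_def] card_conjg[OF g(1) PG, folded P'_def], of "inv g \<otimes> h"]
          g(1) h(1) by auto
      have n2G: "n2 \<in> carrier G" by (rule subgroup.mem_carrier[OF NS n2(1)])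
      \<comment> \<open>Both P and its image under g are identified with Q by elements of the
        normalizer of S; x is g seen through these identifications, so it normalizes Q. Its
        centralizing factor is later conjugated back to P.\<close>
      define x where "x = inv n1 \<otimes> (g \<otimes> n2)"
      have xG: "x \<in> carrier G" using g(1) n1G n2G by (simp add: x_def)
      have "conjg G x ` Q = conjg G (n1 \<otimes> x) ` P"
        unfolding n1(2)[symmetric] by (rule conjg_image_mult[OF n1G xG PG, symmetric])
      also have "n1 \<otimes> x = g \<otimes> n2" using g(1) n1G n2G by (simp add: x_def)
      also have "conjg G (g \<otimes> n2) ` P = Q"
        using conjg_image_mult[OF g(1) n2G PG] n2(2) by (simp add: P'_def)
      finally have "x \<in> L" unfolding L_def using mem_normalizer[OF QG] xG by blast
      then obtain c n where cn: "c \<in> centralizer G Q" "n \<in> normalizer G S" "x = c \<otimes> n"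
        using Qstep by blast
      have G: "c \<in> carrier G" "n \<in> carrier G"
        using cn(1) subgroup.mem_carrier[OF NS cn(2)] by (auto simp: centralizer_def)
      have "conjg G (inv n1) c \<in> centralizer G (conjg G (inv n1) ` Q)"
        by (rule centralizer_conjg[OF QG inv_closed[OF n1G] cn(1)])
      moreover have "conjg G (inv n1) ` Q = P" by (rule conjg_image_inv[OF n1G PG n1(2)])
      moreover have "n1 \<otimes> n \<otimes> inv n2 \<in> normalizer G S"
        using n1(1) n2(1) cn(2) NS by (simp add: subgroup.m_closed subgroup.m_inv_closed)
      moreover have "g = conjg G (inv n1) c \<otimes> (n1 \<otimes> n \<otimes> inv n2)"
      proof -
        have "g = n1 \<otimes> x \<otimes> inv n2" using g(1) n1G n2G by (simp add: x_def m_assoc)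
        then show ?thesis using cn(3) G n1G n2G by (simp add: conjg_def m_assoc)
      qed
      ultimately show ?thesis by metis
    qed
    then show ?thesis unfolding fusion_controlled_def by blast
  qed
qed

end

text \<open>The given D need not lie in Q, but (9) depends on D only through its order, so any
  subgroup of Q of order p^d will do. Its test subgroups lie in S, where the relation to G is
  assumed, and (0) passes it to K.\<close>

lemma p_core_hypercyclic_if_eternal9:
  fixes G :: "'a monoid"
  assumes et: "eternal9 rel" and G: "group G" and fin: "finite (carrier G)"
    and p: "Factorial_Ring.prime p" and K: "subgroup K G"
    and Qc: "p_core p (G\<lparr>carrier := K\<rparr>) = Q" and QS: "Q \<subseteq> S" and S: "subgroup S G"
    and cS: "card S = p ^ s" and d: "0 < d" "p ^ d < card Q"
    and rel: "\<And>H. \<lbrakk>subgroup H G; H \<subseteq> S; card H = p ^ d \<or> card H = p * p ^ d\<rbrakk> \<Longrightarrow> rel H G"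
  shows "hypercyclic (G\<lparr>carrier := K\<rparr>) Q"
proof -
  interpret G: group G by (rule G)
  define M where "M = G\<lparr>carrier := K\<rparr>"
  interpret M: group M unfolding M_def using K by (rule G.subgroup_imp_group)
  have finM: "finite (carrier M)" using G.finite_subgroup[OF fin K] by (simp add: M_def)
  have Qn: "Q \<lhd> M" using M.p_core_normal(1)[OF finM p] Qc by (simp add: M_def)
  then have QM: "subgroup Q M" by (rule normal_imp_subgroup)
  then have Q: "subgroup Q G" "Q \<subseteq> K" using G.subgroup_consistent_iff[OF K] by (auto simp: M_def)
  obtain q where q: "card Q = p ^ q" using G.p_subgroup_card[OF fin p S cS Q(1) QS] by blast
  have p1: "p > 1" using p by (rule prime_gt_1_nat)
  have dq: "d < q" using d(2) q p1 by simp
  have pM: "p dvd Coset.order M"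
  proof -
    have "card Q dvd Coset.order M" using M.lagrange[OF QM] by (metis dvd_triv_right)
    moreover have "p dvd card Q" using q dq by simp
    ultimately show ?thesis using dvd_trans by blast
  qed
  have sub_iff: "subgroup H (M\<lparr>carrier := Q\<rparr>) \<longleftrightarrow> subgroup H G \<and> H \<subseteq> Q" for H
    using G.subgroup_consistent_iff[OF Q(1)] by (simp add: M_def)
  have one: "subgroup {\<one>\<^bsub>G\<^esub>} G" "{\<one>\<^bsub>G\<^esub>} \<subseteq> Q" "card {\<one>\<^bsub>G\<^esub>} = p ^ 0"
    using G.triv_subgroup subgroup.one_closed[OF Q(1)] by auto
  obtain D where D: "subgroup D G" "D \<subseteq> Q" "card D = p ^ d"
    using G.p_subgroup_extend[OF fin p Q(1) q less_imp_le[OF dq] one] by auto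
  have relM: "rel H M" if "subgroup H G" "H \<subseteq> Q" "card H = p ^ d \<or> card H = p * p ^ d" for H
  proof -
    have "rel H G" using that QS by (intro rel) auto
    moreover have "subgroup H (G\<lparr>carrier := K\<rparr>)"
      using that Q(2) by (intro G.subgroup_incl[OF _ K]) auto
    ultimately show ?thesis using et G fin K unfolding eternal9_def M_def by blast
  qed
  have "\<exists>D. subgroup D (M\<lparr>carrier := p_core p M\<rparr>) \<and> 1 < card D \<and> card D < card (p_core p M) \<and>
      (\<forall>H. subgroup H (M\<lparr>carrier := p_core p M\<rparr>) \<and> (card H = card D \<or> card H = p * card D) \<longrightarrow> rel H M)"
    unfolding Qc[folded M_def] sub_iff
    using D d one_less_power[OF p1 d(1)] relM by (intro exI[of _ D]) simp
  then have "p_core p M \<subseteq> supersolvable_hypercenter M"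
    using et[unfolded eternal9_def, rule_format, of M, THEN conjunct2, rule_format, of p]
      M.is_group finM p pM by simp
  then have "Q \<subseteq> supersolvable_hypercenter M" using Qc by (simp add: M_def)
  then show ?thesis
    using M.hypercyclic_hypercenter[OF finM] Qn unfolding M_def[symmetric] hypercyclic_def by blast
qed

theorem theorem3p17:
  fixes rel :: "'a set \<Rightarrow> 'a monoid \<Rightarrow> bool"
    and G :: "'a monoid" and p :: nat and S :: "'a set"
  assumes "eternal9 rel"
    and "group G" and "finite (carrier G)"
    and "Factorial_Ring.prime p" and "p dvd Coset.order G"
    and "sylow_subgroup p G S"
    and "\<exists>D. subgroup D (G\<lparr>carrier := S\<rparr>) \<and> 1 < card D \<and> card D < card S \<and>
             (\<forall>H. subgroup H (G\<lparr>carrier := S\<rparr>) \<and> (card H = card D \<or> card H = p * card D)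
                  \<longrightarrow> comm_group (G\<lparr>carrier := H\<rparr>)) \<and>
             (\<forall>H. subgroup H (G\<lparr>carrier := S\<rparr>) \<and> (card H = card D \<or> card H = p * card D)
                  \<longrightarrow> rel H G)"
  shows "supersolvable_fusion (group_fusion G S) (G\<lparr>carrier := S\<rparr>)"
proof -
  interpret group G by (rule assms(2))
  note fin = assms(3) and p = assms(4) and Ssyl = assms(6)
  have p1: "p > 1" using p by (rule prime_gt_1_nat)
  have S: "subgroup S G" by (rule sylow_subgroup_imp_subgroup[OF Ssyl])
  have SG: "S \<subseteq> carrier G" by (rule subgroup.subset[OF S])
  have finS: "finite S" by (rule finite_subgroup[OF fin S])
  obtain s where s: "card S = p ^ s" using Ssyl by (auto simp: sylow_subgroup_def)
  have sub_iff: "subgroup H (G\<lparr>carrier := S\<rparr>) \<longleftrightarrow> subgroup H G \<and> H \<subseteq> S" for H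
    by (rule subgroup_consistent_iff[OF S])
  obtain D where D: "subgroup D G" "D \<subseteq> S" "1 < card D" "card D < card S"
    and abD: "\<And>H. \<lbrakk>subgroup H G; H \<subseteq> S; card H = p * card D\<rbrakk> \<Longrightarrow> comm_group (G\<lparr>carrier := H\<rparr>)"
    and relD: "\<And>H. \<lbrakk>subgroup H G; H \<subseteq> S; card H = card D \<or> card H = p * card D\<rbrakk> \<Longrightarrow> rel H G"
    using assms(7) unfolding sub_iff by blast
  obtain d where d: "card D = p ^ d" using p_subgroup_card[OF fin p S s D(1,2)] by blast
  have d0: "0 < d" using D(3) d by (cases d) auto
  have ds: "d < s" using D(4) d s p1 by simp
  have core: "hypercyclic (G\<lparr>carrier := K\<rparr>) Q"
    if "subgroup K G" "p_core p (G\<lparr>carrier := K\<rparr>) = Q" "Q \<subseteq> S" "card D < card Q" for K Q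
    using p_core_hypercyclic_if_eternal9[OF assms(1,2) fin p that(1-3) S s d0] that(4) relD
    unfolding d by blast

  have ctrl: "fusion_controlled S P" if "subgroup P G" "P \<subseteq> S" for P
  proof (rule normalizer_controls_fusion[OF fin p Ssyl _ that])
    fix Q x
    assume Q: "subgroup Q G" "Q \<subset> S"
      and Rsyl: "sylow_subgroup p (G\<lparr>carrier := normalizer G Q\<rparr>) (normalizer G Q \<inter> S)"
      and ih: "\<And>U. \<lbrakk>subgroup U G; U \<subseteq> S; card Q < card U\<rbrakk> \<Longrightarrow> fusion_controlled S U"
      and x: "x \<in> normalizer G Q"
    have QS: "Q \<subseteq> S" using Q(2) by blast
    have QG: "Q \<subseteq> carrier G" by (rule subgroup.subset[OF Q(1)])
    obtain q where q: "card Q = p ^ q" using p_subgroup_card[OF fin p S s Q(1) QS] by blast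
    define K where "K = normalizer G Q"
    have K: "subgroup K G" unfolding K_def by (rule normalizer_imp_subgroup[OF QG])
    have xK: "x \<in> K" using x by (simp add: K_def)
    have QK: "Q \<subseteq> K" unfolding K_def by (rule subgroup_subset_normalizer[OF Q(1)])
    have Knorm: "conjg G g ` Q = Q" if "g \<in> K" for g
      using that mem_normalizer[OF QG] by (simp add: K_def)
    define R where "R = K \<inter> S"
    have R: "subgroup R G" unfolding R_def by (rule subgroups_Inter_pair[OF K S])
    have RS: "R \<subseteq> S" and RK: "R \<subseteq> K" and QR: "Q \<subseteq> R" using QK QS by (auto simp: R_def)
    have Rs: "sylow_subgroup p (G\<lparr>carrier := K\<rparr>) R" using Rsyl by (simp add: K_def R_def)
    \<comment> \<open>It suffices to correct x by an element centralizing Q so that it normalizes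
      some larger subgroup of S.\<close>
    have reduce: "\<exists>c\<in>centralizer G Q. \<exists>n\<in>normalizer G S. x = c \<otimes>\<^bsub>G\<^esub> n"
      if U: "subgroup U G" "U \<subseteq> S" "Q \<subset> U" and c: "c \<in> centralizer G Q"
        and y: "y \<in> carrier G" "conjg G y ` U = U" and xy: "x = c \<otimes>\<^bsub>G\<^esub> y" for U c y
    proof -
      have "card Q < card U" by (rule psubset_card_mono[OF finite_subgroup[OF fin U(1)] U(3)])
      then obtain c' n where cn: "c' \<in> centralizer G Q" "n \<in> normalizer G S" "y = c' \<otimes>\<^bsub>G\<^esub> n"
        using fusion_controlledD[OF ih[OF U(1,2)] psubset_imp_subset[OF U(3)] y(1)] y(2) U(2) by metis
      have C: "subgroup (centralizer G Q) G" by (rule centralizer_subgroup[OF QG])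
      have "c \<otimes>\<^bsub>G\<^esub> c' \<in> centralizer G Q" by (rule subgroup.m_closed[OF C c cn(1)])
      moreover have "x = c \<otimes>\<^bsub>G\<^esub> c' \<otimes>\<^bsub>G\<^esub> n"
        using xy cn subgroup.mem_carrier[OF C] c
          subgroup.mem_carrier[OF normalizer_imp_subgroup[OF SG] cn(2)] by (simp add: m_assoc)
      ultimately show ?thesis using cn(2) by blast
    qed
    show "\<exists>c\<in>centralizer G Q. \<exists>n\<in>normalizer G S. x = c \<otimes>\<^bsub>G\<^esub> n"
    proof (cases "card Q \<le> card D")
      case True
      \<comment> \<open>The target exponent d + 1 is that of p|D|. It is at most s because |D| <
        |S|, and A will be strictly larger than Q because |Q| \<le> |D|.\<close>
      have qd: "q \<le> d + 1" using True q d p1 by simp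
      have "d + 1 \<le> s" using ds by simp
      from p_subgroup_extend[OF fin p S s this Q(1) QS q qd]
      obtain A where A: "subgroup A G" "Q \<subseteq> A" "A \<subseteq> S" "card A = p ^ (d + 1)" by blast
      then have "comm_group (G\<lparr>carrier := A\<rparr>)" using d by (intro abD) simp_all
      then have comm: "a \<otimes>\<^bsub>G\<^esub> b = b \<otimes>\<^bsub>G\<^esub> a" if "a \<in> A" "b \<in> A" for a b
        using that comm_groupE(4)[of "G\<lparr>carrier := A\<rparr>"] by simp
      have AC: "A \<subseteq> centralizer G Q"
      proof
        fix a assume a: "a \<in> A"
        have aG: "a \<in> carrier G" by (rule subgroup.mem_carrier[OF A(1) a])
        have "conjg G a y = y" if "y \<in> Q" for y
          using comm[of y a] that a A(2) aG QG by (auto simp: conjg_def m_assoc subset_iff)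
        then show "a \<in> centralizer G Q" using aG by (simp add: centralizer_def)
      qed
      define C where "C = centralizer G Q"
      have C: "subgroup C G" unfolding C_def by (rule centralizer_subgroup[OF QG])
      have CK: "C \<subseteq> K" unfolding C_def K_def by (rule centralizer_subset_normalizer[OF QG])
      have "conjg G g c \<in> C" if "g \<in> K" "c \<in> C" for g c
        using centralizer_conjg[OF QG subgroup.mem_carrier[OF K that(1)], of c] that Knorm
        by (simp add: C_def)
      then have Cn: "C \<lhd> G\<lparr>carrier := K\<rparr>" using normal_consistent_iff[OF K] C CK by blast
      have Us: "sylow_subgroup p (G\<lparr>carrier := C\<rparr>) (R \<inter> C)" by (rule sylow_Int_normal[OF fin p K Rs Cn])
      have U: "subgroup (R \<inter> C) G" by (rule subgroups_Inter_pair[OF R C])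
      obtain c y where cy: "c \<in> C" "y \<in> K" "y \<in> normalizer G (R \<inter> C)" "x = c \<otimes>\<^bsub>G\<^esub> y"
        using frattini[OF fin p K Cn Us xK] .
      \<comment> \<open>A is abelian and contains Q, so it centralizes Q and in particular lies in
        the normalizer K; being inside S as well, it lies in R \<inter> C.\<close>
      have AU: "A \<subseteq> R \<inter> C" using AC A(3) CK by (auto simp: R_def C_def)
      have "p ^ d < p ^ (d + 1)" using p1 by (intro power_strict_increasing) auto
      then have "Q \<noteq> A" using True A(4) d by auto
      then have QU: "Q \<subset> R \<inter> C" using AU A(2) by blast
      have US: "R \<inter> C \<subseteq> S" using RS by blast
      have y: "y \<in> carrier G" "conjg G y ` (R \<inter> C) = R \<inter> C"
        using cy(3) mem_normalizer[OF subgroup.subset[OF U]] by simp_all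
      show ?thesis by (rule reduce[OF U US QU cy(1)[unfolded C_def] y cy(4)])
    next
      case False
      then have big: "card D < card Q" by simp
      interpret K: group "G\<lparr>carrier := K\<rparr>" using K by (rule subgroup_imp_group)
      have finK: "finite (carrier (G\<lparr>carrier := K\<rparr>))" using finite_subgroup[OF fin K] by simp
      define P where "P = p_core p (G\<lparr>carrier := K\<rparr>)"
      note Pn = K.p_core_normal[OF finK p, folded P_def]
      have P: "subgroup P G" "P \<subseteq> K" "\<And>g y. \<lbrakk>g \<in> K; y \<in> P\<rbrakk> \<Longrightarrow> conjg G g y \<in> P"
        using Pn(1) normal_consistent_iff[OF K] by auto
      have Qn: "Q \<lhd> G\<lparr>carrier := K\<rparr>"
        using normal_consistent_iff[OF K] Q(1) QK Knorm by blast
      have QP: "Q \<subseteq> P" by (rule Pn(3)[OF Qn q])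
      obtain r where r: "card P = p ^ r" using Pn(2) by blast
      obtain g where g: "g \<in> K" "conjg G g ` P \<subseteq> R" using sylow_conj_in[OF fin p K Rs P(1,2) r] .
      \<comment> \<open>P is normal in K, so a conjugate of P inside R is P itself, and P lies in
        S.\<close>
      have Pim: "conjg G g ` P = P" if "g \<in> K" for g
        using K.normal_conjg_image[OF Pn(1), of g] that K by simp
      have PS: "P \<subseteq> S" using g Pim RS by blast
      show ?thesis
      proof (cases "P = Q")
        case False
        have "x = \<one>\<^bsub>G\<^esub> \<otimes>\<^bsub>G\<^esub> x" using subgroup.mem_carrier[OF K xK] by simp
        moreover have "Q \<subset> P" using QP False by blast
        ultimately show ?thesis
          using reduce[OF P(1) PS _ subgroup.one_closed[OF centralizer_subgroup[OF QG]]
              subgroup.mem_carrier[OF K xK] Pim[OF xK]] by simp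
      next
        case True
        have hyp: "hypercyclic (G\<lparr>carrier := K\<rparr>) Q"
          using core[OF K _ QS big] True by (simp add: P_def)
        \<comment> \<open>The factorization is made inside K, where R is a Sylow subgroup; the
          centralizer and normalizer taken in K are then translated to G.\<close>
        obtain c y where cy: "c \<in> centralizer (G\<lparr>carrier := K\<rparr>) Q"
          "y \<in> normalizer (G\<lparr>carrier := K\<rparr>) R" "x = c \<otimes>\<^bsub>G\<^esub> y"
          using K.hypercyclic_frattini[OF finK p hyp q Rs, of x] xK by auto
        have cK: "c \<in> K" using cy(1) by (simp add: centralizer_def)
        have c: "c \<in> centralizer G Q"
          using cy(1) subgroup.mem_carrier[OF K cK] conjg_consistent[OF K cK]
          by (simp add: centralizer_def)
        have y: "y \<in> K" "conjg G y ` R = R"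
          using cy(2) K.mem_normalizer[of R y] RK K by auto
        \<comment> \<open>An element of S outside Q that normalizes Q lies in R, so R is strictly
          larger than Q.\<close>
        obtain g where g: "g \<in> S" "g \<notin> Q" "conjg G g ` Q = Q"
          using normalizer_growth[OF fin p S s Q] .
        then have "g \<in> R" using SG mem_normalizer[OF QG] by (auto simp: R_def K_def)
        then have "Q \<subset> R" using g(2) QR by blast
        then show ?thesis
          by (rule reduce[OF R RS _ c subgroup.mem_carrier[OF K y(1)] y(2) cy(3)])
      qed
    qed
  qed

  define K where "K = normalizer G S"
  have K: "subgroup K G" unfolding K_def by (rule normalizer_imp_subgroup[OF SG])
  have SK: "S \<subseteq> K" unfolding K_def by (rule subgroup_subset_normalizer[OF S])
  interpret K: group "G\<lparr>carrier := K\<rparr>" using K by (rule subgroup_imp_group)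
  have finK: "finite (carrier (G\<lparr>carrier := K\<rparr>))" using finite_subgroup[OF fin K] by simp
  have Kim: "conjg G g ` S = S" if "g \<in> K" for g
    using that mem_normalizer[OF SG] by (simp add: K_def)
  have Sn: "S \<lhd> G\<lparr>carrier := K\<rparr>" using normal_consistent_iff[OF K] S SK Kim by blast
  \<comment> \<open>S is a normal p-subgroup of K, hence in its p-core; the p-core is a p-subgroup
    of G and thus no larger than a Sylow subgroup.\<close>
  have core_eq: "p_core p (G\<lparr>carrier := K\<rparr>) = S"
  proof -
    note pc = K.p_core_normal[OF finK p]
    obtain r where r: "card (p_core p (G\<lparr>carrier := K\<rparr>)) = p ^ r" using pc(2) by blast
    have P: "subgroup (p_core p (G\<lparr>carrier := K\<rparr>)) G" using pc(1) normal_consistent_iff[OF K] by blast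
    obtain g where g: "g \<in> carrier G" "conjg G g ` p_core p (G\<lparr>carrier := K\<rparr>) \<subseteq> S"
      using sylow_conj[OF fin p Ssyl P r] .
    have "card (p_core p (G\<lparr>carrier := K\<rparr>)) \<le> card S"
      using card_mono[OF finS g(2)] card_conjg[OF g(1) subgroup.subset[OF P]] by simp
    then show ?thesis
      using card_seteq[OF finite_subgroup[OF fin P] pc(3)[OF Sn s]] by simp
  qed
  have hyp: "hypercyclic (G\<lparr>carrier := K\<rparr>) S" by (rule core[OF K core_eq subset_refl D(4)])
  obtain n T where T: "T (0::nat) = {\<one>\<^bsub>G\<^esub>}" "T n = S"
    and ch: "\<And>i. i < n \<Longrightarrow> chief_factor (G\<lparr>carrier := K\<rparr>) (T (Suc i)) (T i)"
    using K.chief_series[OF finK Sn] by auto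
  have Tn: "T i \<lhd> G\<lparr>carrier := K\<rparr>" "T i \<subseteq> S" if "i \<le> n" for i
    using K.chief_series_terms[of n T i, OF ch] that Sn T(2) by simp_all
  have TG: "subgroup (T i) G" if "i \<le> n" for i
    using Tn(1)[OF that] normal_consistent_iff[OF K] by blast
  \<comment> \<open>On P the map g agrees with an element m normalizing S, and \<open>T i\<close> is
    normal in the normalizer of S, so it is mapped into itself by m.\<close>
  have closed: "strongly_closed (group_fusion G S) (G\<lparr>carrier := S\<rparr>) (T i)" if i: "i \<le> n" for i
    unfolding strongly_closed_def
  proof (intro conjI allI impI; (elim conjE)?)
    show "subgroup (T i) (G\<lparr>carrier := S\<rparr>)" using sub_iff TG[OF i] Tn(2)[OF i] by blast
    fix P \<phi>
    assume "subgroup P (G\<lparr>carrier := S, carrier := T i\<rparr>)"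
      and \<phi>: "\<phi> \<in> group_fusion G S P (carrier (G\<lparr>carrier := S\<rparr>))"
    then have P: "subgroup P G" "P \<subseteq> T i" using subgroup_consistent_iff[OF TG[OF i]] by auto
    obtain g where g: "g \<in> carrier G" "\<phi> = (\<lambda>x\<in>P. conjg G g x)" "\<phi> ` P \<subseteq> S"
      using \<phi> unfolding group_fusion_def conjg_def by auto
    have im: "\<phi> ` P = conjg G g ` P" unfolding g(2) by (intro image_cong) auto
    have PS: "P \<subseteq> S" using P(2) Tn(2)[OF i] by blast
    obtain c m where cm: "c \<in> centralizer G P" "m \<in> normalizer G S" "g = c \<otimes>\<^bsub>G\<^esub> m"
      using fusion_controlledD[OF ctrl[OF P(1) PS] subset_refl g(1)] g(3) im by metis
    have mK: "m \<in> K" using cm(2) by (simp add: K_def)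
    have "conjg G g x \<in> T i" if x: "x \<in> P" for x
    proof -
      have "conjg G g x = conjg G m (conjg G c x)"
        unfolding cm(3)
        using cm(1) subgroup.mem_carrier[OF K mK] subgroup.mem_carrier[OF P(1) x]
        by (intro conjg_mult) (auto simp: centralizer_def)
      also have "\<dots> = conjg G m x" using cm(1) x by (simp add: centralizer_def)
      finally show ?thesis
        using Tn(1)[OF i] normal_consistent_iff[OF K] mK x P(2) by auto
    qed
    then show "\<phi> ` P \<subseteq> T i" unfolding im by blast
  qed
  have factor: "T i \<subseteq> T (Suc i) \<and> T i \<lhd> G\<lparr>carrier := T (Suc i)\<rparr> \<and>
      cyclic_group (G\<lparr>carrier := T (Suc i)\<rparr> Mod T i)" if i: "i < n" for i
  proof -
    note c = K.chief_factorD[OF ch[OF i]]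
    have s: "subgroup (T (Suc i)) G" "subgroup (T (Suc i)) (G\<lparr>carrier := K\<rparr>)"
      using TG[of "Suc i"] K.normalD(1)[OF c(1)] i by auto
    have nr: "T i \<lhd> G\<lparr>carrier := T (Suc i)\<rparr>"
      using K.normal_restrict_supergroup[OF s(2) c(2)] c(3) by auto
    have "cyclic_over (G\<lparr>carrier := K\<rparr>) (T (Suc i)) (T i)"
      using hyp ch[OF i] Tn(2)[of "Suc i"] i unfolding hypercyclic_def by auto
    then have "cyclic_group (G\<lparr>carrier := K\<rparr>\<lparr>carrier := T (Suc i)\<rparr> Mod T i)"
      using K.cyclic_Mod_subgroup_iff[OF s(2)] nr by simp
    then show ?thesis using nr c(3) by auto
  qed
  show ?thesis
    unfolding supersolvable_fusion_def
    using T closed factor by (intro exI[of _ n] exI[of _ T]) simp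
qed

end
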